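(* Let $R:V\otimes V\to V\otimes V\otimes B$ be $$R(e_i\otimes e_j)=e_i\otimes e_j\otimes\alpha\big((K_{\alpha_{ji}}q^{-\delta_{ij}})^2\big)+e_j\otimes e_i\otimes\beta\big((K_{\alpha_{ij}}q^{-\delta_{ij}})^2\big),\qquad \alpha(x)=\frac{q-q^{-1}}{1-x},\quad \beta(x)=\frac{q^{-1}-qx}{1-x},$$ and let $\rho:V\otimes V\to V\otimes V$ be the standard Cremmer-Gervais $R$-matrix $$\rho(e_i\otimes e_j)=q\,q^{2(i-j)/n}\,e_j\otimes e_i+\sum_k\hat q\,q^{2(i-k)/n}\,\eta(i,j,k)\,e_k\otimes e_{i+j-k},\qquad \hat q=q-q^{-1}.$$ Let $A:V\to V\otimes B$ be the linear map $A(e_i)=\sum_a e_a\otimes K_{\nu_a}^{-2i}$. Then $R^A=\rho$, where $R^A=A_2^{-1}A_1^{-1}RA_1A_2$.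
   Context: $\mathbb{F}$ is a field, $q\in\mathbb{F}$ is non-zero with $q^2\neq1$, and $q^{2/n}\in\mathbb{F}$ denotes an $n$-th root of $q^2$. $T$ is the usual maximal torus of $SL(n)$, $P$ is the weight lattice and $Q\subset P$ the root lattice; $\nu_1,\dots,\nu_n\in P$ are the weights of the standard representation (with $\sum_i\nu_i=0$), with $(\nu_i,\nu_j)=\delta_{ij}-\frac1n$, and $\alpha_{ij}=\nu_i-\nu_j$. $H=\mathbb{F}[T]=\mathbb{F}[K_\lambda\mid\lambda\in P]$ is the group algebra of $P$ (so $K_\lambda K_\mu=K_{\lambda+\mu}$). $B=\operatorname{Frac}(\mathbb{F}[K_\alpha\mid\alpha\in Q])$ is the field of fractions of the subalgebra of $H$ generated by the root lattice, with action $\sigma:H\otimes B\to B$ given by $\sigma(K_\lambda\otimes K_\alpha)=q^{(\lambda,\alpha)}K_\alpha$; write $b^\lambda=\sigma(K_\lambda\otimes b)$. For the entries of $A$ the same formula is used, so $(K_{\nu_m}^{-2a})^{\nu_s}=q^{-2a\delta_{ms}+2a/n}K_{\nu_m}^{-2a}$. $V$ is the $n$-dimensional right $H$-comodule with basis $e_1,\dots,e_n$ and coaction $e_i\mapsto e_i\otimes K_{\nu_i}$. Linear maps $f:U\to W\otimes B$ are composed by identifying $f$ with the map $U\otimes B\to W\otimes B$, $u\otimes b\mapsto f(u)b$; inverses are with respect to this composition. The operator $\rho$ is regarded as a map $V\otimes V\to V\otimes V\otimes\mathbb{F}\subset V\otimes V\otimes B$. For an $H$-comodule $W$ with coaction $w\mapsto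 w_0\otimes w_1$, let $\tau:B\otimes W\to W\otimes B$, $\tau(b\otimes w)=w_0\otimes\sigma(w_1\otimes b)$; for linear maps $f:U\to U'\otimes B$, $g:W\to W'\otimes B$ between $H$-comodules put $f\tilde\otimes g=(1\otimes m_B)(1\otimes\tau\otimes1)(f\otimes g):U\otimes W\to U'\otimes W'\otimes B$, with $m_B$ the multiplication of $B$. Then $A_1=A\tilde\otimes1$ and $A_2=1\tilde\otimes A$, as maps $V\otimes V\to V\otimes V\otimes B$. Explicitly, if $A(e_i)=\sum_c e_c\otimes A^c_i$, then $A_1(e_i\otimes e_j)=\sum_c e_c\otimes e_j\otimes(A^c_i)^{\nu_j}$ and $A_2(e_i\otimes e_j)=\sum_d e_i\otimes e_d\otimes A^d_j$. The function $\eta$ is defined by $\eta(i,j,k)=1$ if $i\le k<j$, $\eta(i,j,k)=-1$ if $j\le k<i$, and $\eta(i,j,k)=0$ otherwise. *)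

theory Defs
  imports
    Complex_Main
    "HOL-Library.Poly_Mapping"
    "HOL-Computational_Algebra.Fraction_Field"
    "HOL-Computational_Algebra.Group_Closure"
begin

text \<open>
  Weights live in \<open>\<rat>\<^sup>n\<close> with its standard bilinear form (coordinates \<open>1..n\<close>, realised as finitely
  supported functions on \<^typ>\<open>nat\<close>), and \<open>\<nu>\<^sub>i\<close> is the projection of the \<open>i\<close>-th unit vector to the
  hyperplane of coordinate sum \<open>0\<close>.
\<close>

type_synonym weight = "nat \<Rightarrow>\<^sub>0 rat"

definition pairing :: "weight \<Rightarrow> weight \<Rightarrow> rat" where
  "pairing \<kappa> \<mu> = (\<Sum>i\<in>Poly_Mapping.keys \<kappa>. Poly_Mapping.lookup \<kappa> i * Poly_Mapping.lookup \<mu> i)"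

definition nu :: "nat \<Rightarrow> nat \<Rightarrow> weight" where
  "nu n i = Poly_Mapping.single i 1 - (\<Sum>j=1..n. Poly_Mapping.single j (1 / of_nat n))"

definition wt_root :: "nat \<Rightarrow> nat \<Rightarrow> nat \<Rightarrow> weight" where
  "wt_root n i j = nu n i - nu n j"

definition weight_lattice :: "nat \<Rightarrow> weight set" where
  "weight_lattice n = group_closure (nu n ` {1..n})"

definition root_lattice :: "nat \<Rightarrow> weight set" where
  "root_lattice n = group_closure {wt_root n i j | i j. i \<in> {1..n} \<and> j \<in> {1..n}}"

text \<open>
  \<open>Q + 2P\<close>: the exponents that occur in \<open>B\<close> together with those of the entries \<open>K\<^bsub>\<nu>\<^esub>\<^bsup>-2i\<^esup>\<close> of \<open>A\<close>,
  which do not all lie in \<open>Q\<close>.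
\<close>
definition ext_lattice :: "nat \<Rightarrow> weight set" where
  "ext_lattice n = group_closure (root_lattice n \<union> (\<lambda>\<omega>. \<omega> + \<omega>) ` weight_lattice n)"

lemma pairing_nu:
  assumes "i \<in> {1..n}" "j \<in> {1..n}"
  shows "pairing (nu n i) (nu n j) = (if i = j then 1 else 0) - 1 / of_nat n"
proof -
  have l: "Poly_Mapping.lookup (nu n i) k
      = (if k = i then 1 else 0) - (if k \<in> {1..n} then 1 / of_nat n else 0)" for i k
    by (auto simp: nu_def lookup_minus lookup_sum lookup_single when_def)
  have "pairing (nu n i) (nu n j)
      = (\<Sum>k=1..n. Poly_Mapping.lookup (nu n i) k * Poly_Mapping.lookup (nu n j) k)"
    unfolding pairing_def
    by (rule sum.mono_neutral_left)
       (use assms in \<open>auto simp: in_keys_iff l split: if_splits\<close>)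
  also have "\<dots> = (\<Sum>k=1..n. (if k = i then (if i = j then 1 else 0) - 1 / of_nat n else 0)
      - (if k = j then 1 / of_nat n else 0) + 1 / of_nat n * (1 / of_nat n))"
    by (rule sum.cong) (auto simp: l algebra_simps)
  also have "\<dots> = (if i = j then 1 else 0) - 1 / of_nat n"
    using assms by (simp add: sum.distrib sum_subtractf)
  finally show ?thesis .
qed

text \<open>
  \<open>F[K\<^sub>\<mu>]\<close> is the type \<^typ>\<open>weight \<Rightarrow>\<^sub>0 'f\<close> with the convolution product; \<open>H\<close> consists of the elements
  supported in \<open>P\<close>.
\<close>

type_synonym 'f galg = "weight \<Rightarrow>\<^sub>0 'f"
type_synonym 'f ffield = "(weight \<Rightarrow>\<^sub>0 'f) fract"

definition scal :: "'f :: field \<Rightarrow> 'f ffield" where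
  "scal c = Fract (Poly_Mapping.single 0 c) 1"

definition K :: "weight \<Rightarrow> ('f :: field) ffield" where
  "K \<mu> = Fract (Poly_Mapping.single \<mu> 1) 1"

definition group_algebra :: "weight set \<Rightarrow> ('f :: field) galg set" where
  "group_algebra S = {a. Poly_Mapping.keys a \<subseteq> S}"

definition fracs :: "weight set \<Rightarrow> ('f :: field) ffield set" where
  "fracs S = {Fract a b | a b. a \<in> group_algebra S \<and> b \<in> group_algebra S \<and> b \<noteq> 0}"

definition B_field :: "nat \<Rightarrow> ('f :: field) ffield set" where
  "B_field n = fracs (root_lattice n)"

definition B_ext :: "nat \<Rightarrow> ('f :: field) ffield set" where
  "B_ext n = fracs (ext_lattice n)"

text \<open>
  \<open>q\<^sup>x\<close> for \<open>x \<in> \<int> + (2/n)\<int>\<close>, where \<open>r\<close> is the chosen \<open>n\<close>-th root \<open>q\<^bsup>2/n\<^esup>\<close> of \<open>q\<^sup>2\<close>: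
  for \<open>x = 2k/n\<close> this is \<open>r\<^sup>k\<close>, for \<open>x = 1 + 2k/n\<close> it is \<open>q r\<^sup>k\<close>.  These readings could only
  disagree for even \<open>n\<close> and \<open>r\<^bsup>n/2\<^esup> = -q\<close>; then \<open>r\<^sup>k\<close> takes precedence, so that
  \<open>(K\<^bsub>\<nu>\<^sub>m\<^esub>\<^bsup>-2a\<^esup>)\<^bsup>\<nu>\<^sub>s\<^esup> = q\<^bsup>-2a\<delta>\<^esup> r\<^sup>a K\<^bsub>\<nu>\<^sub>m\<^esub>\<^bsup>-2a\<^esup>\<close> for every choice of the root.
  Lemmas \<open>qpow_root\<close> and \<open>qpow_int\<close> below record this.
\<close>
definition qpow :: "nat \<Rightarrow> 'f :: field \<Rightarrow> 'f \<Rightarrow> rat \<Rightarrow> 'f" where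
  "qpow n q r x =
    (if of_nat n * x / 2 \<in> \<int> then r powi \<lfloor>of_nat n * x / 2\<rfloor>
     else q * r powi \<lfloor>of_nat n * (x - 1) / 2\<rfloor>)"

lemma qpow_root:
  assumes "n \<noteq> 0"
  shows "qpow n q r (2 * of_int k / of_nat n) = r powi k"
  using assms by (simp add: qpow_def)

lemma qpow_int:
  assumes n: "n \<noteq> 0" and q: "q \<noteq> 0" and r: "r ^ n = q\<^sup>2" and c: "even n \<Longrightarrow> r ^ (n div 2) = q"
  shows "qpow n q r (of_int k) = q powi k"
proof (cases "even n")
  case True
  then obtain m where m: "n = 2 * m" by blast
  have "qpow n q r (of_int k) = r powi (int m * k)"
    unfolding qpow_def m
    by (metis (no_types, lifting) Ints_of_int floor_of_int mult.assoc nonzero_mult_div_cancel_left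
        of_int_mult of_int_of_nat_eq of_nat_mult of_nat_numeral zero_neq_numeral)
  also have "\<dots> = q powi k" using c[OF True] m by (simp add: power_int_mult)
  finally show ?thesis .
next
  case False
  have r0: "r \<noteq> 0" using r q n by (auto simp: power_0_left)
  show ?thesis
  proof (cases "even k")
    case True
    then obtain j where j: "k = 2 * j" by blast
    have "of_nat n * of_int k / 2 = (of_int (int n * j) :: rat)" by (simp add: j)
    then have "qpow n q r (of_int k) = r powi (int n * j)"
      unfolding qpow_def by (metis Ints_of_int floor_of_int)
    also have "\<dots> = (q\<^sup>2) powi j" using r by (simp add: power_int_mult)
    also have "\<dots> = q powi k" by (simp add: j power_int_mult)
    finally show ?thesis .
  next
    case odd: False
    then obtain j where j: "k = 2 * j + 1" by (elim oddE)
    have no: "of_nat n * of_int k / 2 \<notin> (\<int> :: rat set)"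
    proof
      assume "of_nat n * of_int k / 2 \<in> (\<int> :: rat set)"
      then obtain z where "of_nat n * of_int k / 2 = (of_int z :: rat)" by (elim Ints_cases)
      then have "(of_int (int n * k) :: rat) = of_int (2 * z)" by simp
      then have "int n * k = 2 * z" by (simp only: of_int_eq_iff)
      then have "even (int n * k)" by simp
      then show False using odd \<open>odd n\<close> by simp
    qed
    have e: "of_nat n * (of_int k - 1) / 2 = (of_int (int n * j) :: rat)" by (simp add: j)
    have "qpow n q r (of_int k) = q * r powi (int n * j)"
      unfolding qpow_def e floor_of_int using no by simp
    also have "\<dots> = q * (q\<^sup>2) powi j" using r by (simp add: power_int_mult)
    also have "\<dots> = q powi k" using q by (simp add: j power_int_add power_int_mult)
    finally show ?thesis .
  qed
qed

definition twist :: "nat \<Rightarrow> 'f :: field \<Rightarrow> 'f \<Rightarrow> weight \<Rightarrow> 'f galg \<Rightarrow> 'f galg" where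
  "twist n q r \<kappa> a = Poly_Mapping.mapp (\<lambda>\<mu> c. qpow n q r (pairing \<kappa> \<mu>) * c) a"

text \<open>
  \<open>b \<mapsto> b\<^sup>\<kappa>\<close>, the extension to fractions of \<open>K\<^sub>\<mu> \<mapsto> q\<^bsup>(\<kappa>,\<mu>)\<^esup> K\<^sub>\<mu>\<close>.  Numerator and denominator
  are taken in the group algebra of \<open>Q + 2P\<close>: on all weights the formula would not be multiplicative.
\<close>
definition shift :: "nat \<Rightarrow> 'f :: field \<Rightarrow> 'f \<Rightarrow> weight \<Rightarrow> 'f ffield \<Rightarrow> 'f ffield" where
  "shift n q r \<kappa> b = (THE c. \<exists>x\<in>group_algebra (ext_lattice n). \<exists>y\<in>group_algebra (ext_lattice n).
     y \<noteq> 0 \<and> b = Fract x y \<and> c = Fract (twist n q r \<kappa> x) (twist n q r \<kappa> y))"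

definition sigma :: "nat \<Rightarrow> 'f :: field \<Rightarrow> 'f \<Rightarrow> 'f galg \<Rightarrow> 'f ffield \<Rightarrow> 'f ffield" where
  "sigma n q r h b =
    (\<Sum>\<kappa>\<in>Poly_Mapping.keys h. scal (Poly_Mapping.lookup h \<kappa>) * shift n q r \<kappa> b)"

text \<open>
  A linear map from a space with basis \<open>I\<close> to \<open>W \<otimes> B\<close>, where \<open>W\<close> has basis \<open>J\<close>, is given by the
  images of the basis vectors, extended by \<open>0\<close> outside \<open>I\<close>; \<open>e\<^sub>j \<otimes> b\<close> is
  \<^term>\<open>Poly_Mapping.single j b\<close>.  The basis of \<open>V \<otimes> V\<close> consists of pairs of indices.
\<close>

type_synonym ('u, 'w, 'b) lmap = "'u \<Rightarrow> ('w \<Rightarrow>\<^sub>0 'b)"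

definition lmaps :: "'b :: zero set \<Rightarrow> 'u set \<Rightarrow> 'w set \<Rightarrow> ('u, 'w, 'b) lmap set" where
  "lmaps S I J = {f. (\<forall>u\<in>I. Poly_Mapping.keys (f u) \<subseteq> J \<and> (\<forall>w\<in>J. Poly_Mapping.lookup (f u) w \<in> S))
                   \<and> (\<forall>u. u \<notin> I \<longrightarrow> f u = 0)}"

definition idmap :: "'u set \<Rightarrow> ('u, 'u, 'b :: field) lmap" where
  "idmap I u = (if u \<in> I then Poly_Mapping.single u 1 else 0)"

definition lcomp :: "('v, 'w, 'b :: field) lmap \<Rightarrow> ('u, 'v, 'b) lmap \<Rightarrow> ('u, 'w, 'b) lmap"
    (infixl "\<odot>" 70) where
  "(f \<odot> g) u = (\<Sum>v\<in>Poly_Mapping.keys (g u).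
     Poly_Mapping.map (\<lambda>c. c * Poly_Mapping.lookup (g u) v) (f v))"

definition is_inverse ::
    "'b :: field set \<Rightarrow> 'u set \<Rightarrow> ('u, 'u, 'b) lmap \<Rightarrow> ('u, 'u, 'b) lmap \<Rightarrow> bool" where
  "is_inverse S I f g \<longleftrightarrow> g \<in> lmaps S I I \<and> g \<odot> f = idmap I \<and> f \<odot> g = idmap I"

definition invertible_map :: "'b :: field set \<Rightarrow> 'u set \<Rightarrow> ('u, 'u, 'b) lmap \<Rightarrow> bool" where
  "invertible_map S I f \<longleftrightarrow> f \<in> lmaps S I I \<and> (\<exists>g. is_inverse S I f g)"

definition inv_map :: "'b :: field set \<Rightarrow> 'u set \<Rightarrow> ('u, 'u, 'b) lmap \<Rightarrow> ('u, 'u, 'b) lmap" where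
  "inv_map S I f = (THE g. is_inverse S I f g)"

text \<open>A linear map \<open>U \<rightarrow> W\<close> viewed as \<open>U \<rightarrow> W \<otimes> F \<subseteq> W \<otimes> B\<close>.\<close>
definition of_scalar_map :: "('u \<Rightarrow> ('w \<Rightarrow>\<^sub>0 'f :: field)) \<Rightarrow> ('u, 'w, 'f ffield) lmap" where
  "of_scalar_map f u = Poly_Mapping.map scal (f u)"

type_synonym ('w, 'f) coaction = "'w \<Rightarrow> ('w \<Rightarrow>\<^sub>0 'f galg)"

definition coact_V :: "nat \<Rightarrow> (nat, 'f :: field) coaction" where
  "coact_V n i = (if i \<in> {1..n} then Poly_Mapping.single i (Poly_Mapping.single (nu n i) 1) else 0)"

text \<open>\<open>\<tau>(b \<otimes> w) = w\<^sub>0 \<otimes> \<sigma>(w\<^sub>1 \<otimes> b)\<close>\<close>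
definition tau ::
    "nat \<Rightarrow> 'f :: field \<Rightarrow> 'f \<Rightarrow> ('w, 'f) coaction \<Rightarrow> 'f ffield \<Rightarrow> 'w \<Rightarrow> ('w \<Rightarrow>\<^sub>0 'f ffield)" where
  "tau n q r \<delta> b w = (\<Sum>w'\<in>Poly_Mapping.keys (\<delta> w).
     Poly_Mapping.single w' (sigma n q r (Poly_Mapping.lookup (\<delta> w) w') b))"

text \<open>\<open>(1 \<otimes> m\<^sub>B)(1 \<otimes> \<tau> \<otimes> 1)(f \<otimes> g)\<close>, where \<open>\<delta>\<close> is the coaction on the target of \<open>g\<close>.\<close>
definition tensor_map ::
    "nat \<Rightarrow> 'f :: field \<Rightarrow> 'f \<Rightarrow> ('d, 'f) coaction \<Rightarrow>
     ('u, 'c, 'f ffield) lmap \<Rightarrow> ('v, 'd, 'f ffield) lmap \<Rightarrow> ('u \<times> 'v, 'c \<times> 'd, 'f ffield) lmap" where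
  "tensor_map n q r \<delta> f g = (\<lambda>(u, v).
     \<Sum>c\<in>Poly_Mapping.keys (f u). \<Sum>d\<in>Poly_Mapping.keys (g v).
       let t = tau n q r \<delta> (Poly_Mapping.lookup (f u) c) d in
       \<Sum>d'\<in>Poly_Mapping.keys t.
         Poly_Mapping.single (c, d') (Poly_Mapping.lookup t d' * Poly_Mapping.lookup (g v) d))"

definition V_basis :: "nat \<Rightarrow> nat set" where
  "V_basis n = {1..n}"

definition VV_basis :: "nat \<Rightarrow> (nat \<times> nat) set" where
  "VV_basis n = V_basis n \<times> V_basis n"

definition alpha_fun :: "'b :: field \<Rightarrow> 'b \<Rightarrow> 'b" where
  "alpha_fun q x = (q - inverse q) / (1 - x)"

definition beta_fun :: "'b :: field \<Rightarrow> 'b \<Rightarrow> 'b" where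
  "beta_fun q x = (inverse q - q * x) / (1 - x)"

definition R_op :: "nat \<Rightarrow> 'f :: field \<Rightarrow> (nat \<times> nat, nat \<times> nat, 'f ffield) lmap" where
  "R_op n q = (\<lambda>(i, j). if (i, j) \<in> VV_basis n then
     let d = (if i = j then inverse (scal q) else 1) in
       Poly_Mapping.single (i, j) (alpha_fun (scal q) ((K (wt_root n j i) * d)\<^sup>2))
     + Poly_Mapping.single (j, i) (beta_fun (scal q) ((K (wt_root n i j) * d)\<^sup>2))
   else 0)"

definition eta :: "nat \<Rightarrow> nat \<Rightarrow> nat \<Rightarrow> int" where
  "eta i j k = (if i \<le> k \<and> k < j then 1 else if j \<le> k \<and> k < i then -1 else 0)"

text \<open>The truncated \<open>i + j - k\<close> is harmless: \<open>\<eta>(i,j,k) \<noteq> 0\<close> forces \<open>1 \<le> i + j - k \<le> n\<close>.\<close>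
definition rho :: "nat \<Rightarrow> 'f :: field \<Rightarrow> 'f \<Rightarrow> nat \<times> nat \<Rightarrow> (nat \<times> nat \<Rightarrow>\<^sub>0 'f)" where
  "rho n q r = (\<lambda>(i, j). if (i, j) \<in> VV_basis n then
     Poly_Mapping.single (j, i) (q * r powi (int i - int j))
     + (\<Sum>k=1..n. Poly_Mapping.single (k, i + j - k)
          ((q - inverse q) * r powi (int i - int k) * of_int (eta i j k)))
   else 0)"

definition A_op :: "nat \<Rightarrow> (nat, nat, ('f :: field) ffield) lmap" where
  "A_op n i = (if i \<in> V_basis n then
     \<Sum>a=1..n. Poly_Mapping.single a (K (nu n a) powi (- 2 * int i)) else 0)"

definition A1 :: "nat \<Rightarrow> 'f :: field \<Rightarrow> 'f \<Rightarrow> (nat \<times> nat, nat \<times> nat, 'f ffield) lmap" where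
  "A1 n q r = tensor_map n q r (coact_V n) (A_op n) (idmap (V_basis n))"

definition A2 :: "nat \<Rightarrow> 'f :: field \<Rightarrow> 'f \<Rightarrow> (nat \<times> nat, nat \<times> nat, 'f ffield) lmap" where
  "A2 n q r = tensor_map n q r (coact_V n) (idmap (V_basis n)) (A_op n)"

definition R_gauge :: "nat \<Rightarrow> 'f :: field \<Rightarrow> 'f \<Rightarrow> (nat \<times> nat, nat \<times> nat, 'f ffield) lmap" where
  "R_gauge n q r =
     inv_map (B_ext n) (VV_basis n) (A2 n q r) \<odot> inv_map (B_ext n) (VV_basis n) (A1 n q r)
     \<odot> R_op n q \<odot> A1 n q r \<odot> A2 n q r"

end

theory Submission
  imports Defs "HOL-Computational_Algebra.Polynomial"
begin

text \<open>
  Write \<open>y\<^sub>c = K\<^bsub>\<nu>\<^sub>c\<^esub>\<^bsup>-2\<^esup>\<close>, so that \<open>A(e\<^sub>i) = \<Sum>\<^sub>c e\<^sub>c \<otimes> y\<^sub>c\<^sup>i\<close>: the operator \<open>A\<close> is a Vandermonde matrix.  The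
  weight of \<open>e\<^sub>d\<close> acts on \<open>y\<^sub>c\<close> by the factor \<open>r q\<^bsup>-2\<delta>\<^esup>\<close> with \<open>\<delta> = \<delta>\<^sub>c\<^sub>d\<close> and \<open>r = q\<^bsup>2/n\<^esup>\<close>.  Hence, with
  \<open>x\<^sub>c\<^sub>d = q\<^bsup>-2\<delta>\<^esup> y\<^sub>c\<close>, the operator \<open>A\<^sub>1\<close> is the block sum over \<open>d\<close> of the Vandermonde matrices with nodes
  \<open>r x\<^sub>c\<^sub>d\<close>, and \<open>A\<^sub>2\<close> is \<open>n\<close> copies of the one with nodes \<open>y\<^sub>d\<close>.  In each block the nodes are distinct and non-zero
  elements of a field, so both operators are invertible, with inverses given by Lagrange interpolation
  over that same field.

  It remains to see \<open>R A\<^sub>1 A\<^sub>2 = A\<^sub>1 A\<^sub>2 \<rho>\<close>, an identity of matrix entries.  The entry of \<open>A\<^sub>1 A\<^sub>2\<close> from \<open>e\<^sub>i \<otimes> e\<^sub>j\<close>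
  to \<open>e\<^sub>c \<otimes> e\<^sub>d\<close> is \<open>r\<^sup>i x\<^sup>i y\<^sup>j\<close> with \<open>x = x\<^sub>c\<^sub>d\<close> and \<open>y = y\<^sub>d\<close>, and both \<open>\<alpha>\<close> and \<open>\<beta>\<close> in row \<open>e\<^sub>c \<otimes> e\<^sub>d\<close> of \<open>R\<close>
  are evaluated at \<open>x / y\<close>.  For \<open>c \<noteq> d\<close> passing to \<open>e\<^sub>d \<otimes> e\<^sub>c\<close> exchanges \<open>x\<close> and \<open>y\<close>; for \<open>c = d\<close> it does
  not, but there \<open>x / y = q\<^bsup>-2\<^esup>\<close> is the zero of \<open>\<beta>\<close>.  So in all cases the claim, divided by \<open>r\<^sup>i\<close>, reads
  \<open>\<alpha> x\<^sup>i y\<^sup>j + \<beta> y\<^sup>i x\<^sup>j = q x\<^sup>j y\<^sup>i + (q - q\<^bsup>-1\<^esup>) (\<Sum>\<^sub>k \<eta>(i,j,k) x\<^sup>k y\<^bsup>i+j-k\<^esup>)\<close>.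
  Since \<open>\<alpha> + \<beta> = q\<close> this only says that \<open>y (x\<^sup>i y\<^sup>j - x\<^sup>j y\<^sup>i) / (y - x)\<close> is the sum on the right, which is
  a finite geometric series (\<open>alpha_beta_eta\<close>, \<open>eta_sum_telescope\<close>).
\<close>

section \<open>Subfields\<close>

locale subfield =
  fixes S :: "'b :: field set"
  assumes zero: "0 \<in> S" and one: "1 \<in> S"
    and diff: "x \<in> S \<Longrightarrow> y \<in> S \<Longrightarrow> x - y \<in> S"
    and mult: "x \<in> S \<Longrightarrow> y \<in> S \<Longrightarrow> x * y \<in> S"
    and inverse: "x \<in> S \<Longrightarrow> inverse x \<in> S"
begin

lemma uminus: "x \<in> S \<Longrightarrow> - x \<in> S"
  using diff[OF zero, of x] by simp

lemma add: "x \<in> S \<Longrightarrow> y \<in> S \<Longrightarrow> x + y \<in> S"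
  using diff[OF _ uminus, of x y] by simp

lemma divide: "x \<in> S \<Longrightarrow> y \<in> S \<Longrightarrow> x / y \<in> S"
  by (simp add: divide_inverse mult inverse)

lemma power: "x \<in> S \<Longrightarrow> x ^ k \<in> S"
  by (induction k) (auto intro: mult one)

lemma sum: "(\<And>i. i \<in> I \<Longrightarrow> f i \<in> S) \<Longrightarrow> sum f I \<in> S"
  by (induction I rule: infinite_finite_induct) (auto intro: add zero)

text \<open>
  This keeps the coefficients of Lagrange polynomials, hence the inverse Vandermonde matrix, in a
  subfield that contains the nodes.
\<close>
lemma coeff_prod:
  "(\<And>i k. i \<in> I \<Longrightarrow> coeff (p i) k \<in> S) \<Longrightarrow> coeff (\<Prod>i\<in>I. p i) k \<in> S"
proof (induction I arbitrary: k rule: infinite_finite_induct)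
  case (insert i I)
  then show ?case
    by (auto simp: coeff_mult intro!: sum mult)
qed (auto simp: coeff_1 intro: zero one)

end

section \<open>Vandermonde matrices\<close>

definition lagrange_poly :: "'i set \<Rightarrow> ('i \<Rightarrow> 'b :: field) \<Rightarrow> 'i \<Rightarrow> 'b poly" where
  "lagrange_poly I y c = (\<Prod>d\<in>I - {c}. smult (inverse (y c - y d)) [:- y d, 1:])"

text \<open>
  For distinct non-zero nodes, the inverse of the matrix \<open>y\<^sub>c\<^sup>k\<close> with exponents \<open>k = 1, \<dots>, |I|\<close>.  As the
  exponents start at \<open>1\<close>, that matrix is the usual Vandermonde matrix with row \<open>c\<close> multiplied by \<open>y\<^sub>c\<close>: hence the division and the shift to \<open>k - 1\<close>.
\<close>
definition vandermonde_inv :: "'i set \<Rightarrow> ('i \<Rightarrow> 'b :: field) \<Rightarrow> nat \<Rightarrow> 'i \<Rightarrow> 'b" where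
  "vandermonde_inv I y k c = coeff (lagrange_poly I y c) (k - 1) / y c"

lemma poly_lagrange_poly:
  assumes "finite I" "inj_on y I" "c \<in> I" "d \<in> I"
  shows "poly (lagrange_poly I y c) (y d) = (if c = d then 1 else 0)"
proof (cases "c = d")
  case True
  have "poly (smult (inverse (y c - y e)) [:- y e, 1:]) (y c) = 1" if "e \<in> I - {c}" for e
  proof -
    have "y c - y e \<noteq> 0"
      using assms that by (auto dest: inj_onD)
    then show ?thesis by (simp add: divide_simps)
  qed
  then show ?thesis
    unfolding True[symmetric] lagrange_poly_def poly_prod by (simp add: prod.neutral)
next
  case False
  then show ?thesis
    using assms by (auto simp: lagrange_poly_def poly_prod intro!: prod_zero bexI[of _ d])
qed

lemma degree_lagrange_poly:
  assumes "finite I" "c \<in> I"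
  shows "degree (lagrange_poly I y c) < card I"
proof -
  have "degree (lagrange_poly I y c)
      \<le> (\<Sum>d\<in>I - {c}. degree (smult (inverse (y c - y d)) [:- y d, 1:]))"
    unfolding lagrange_poly_def using assms
    by (intro order.trans[OF degree_prod_sum_le]) (simp_all add: o_def)
  also have "\<dots> \<le> (\<Sum>d\<in>I - {c}. 1)"
    by (intro sum_mono) (simp add: degree_smult_le)
  also have "\<dots> < card I"
    using assms card_gt_0_iff[of I] by auto
  finally show ?thesis .
qed

lemma (in subfield) vandermonde_inv_closed:
  assumes "\<And>c. c \<in> I \<Longrightarrow> y c \<in> S" "c \<in> I"
  shows "vandermonde_inv I y k c \<in> S"
proof -
  have "coeff (lagrange_poly I y c) m \<in> S" for m
    unfolding lagrange_poly_def using assms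
    by (intro coeff_prod)
       (auto simp: coeff_pCons split: nat.split intro!: mult inverse diff uminus zero one)
  then show ?thesis
    using assms by (auto simp: vandermonde_inv_def intro: divide)
qed

text \<open>
  Lagrange interpolation of the monomial of degree \<open>l - 1\<close> reproduces it, because its degree is less
  than the number of nodes.  Comparing coefficients gives the matrix identity.
\<close>
lemma vandermonde_inv_left:
  assumes I: "finite I" "inj_on y I" "\<And>c. c \<in> I \<Longrightarrow> y c \<noteq> 0"
    and k: "k \<in> {1..card I}" and l: "l \<in> {1..card I}"
  shows "(\<Sum>c\<in>I. vandermonde_inv I y k c * y c ^ l) = (if k = l then 1 else 0)"
proof -
  let ?p = "\<Sum>c\<in>I. smult (y c ^ (l - 1)) (lagrange_poly I y c)"
  have "?p = monom 1 (l - 1)"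
  proof (rule poly_eqI_degree[where A = "y ` I"])
    fix x assume "x \<in> y ` I"
    then obtain d where d: "d \<in> I" "x = y d" by blast
    have "poly ?p x = (\<Sum>c\<in>I. if c = d then y c ^ (l - 1) else 0)"
      unfolding d poly_sum poly_smult
      by (rule sum.cong) (use I d in \<open>auto simp: poly_lagrange_poly\<close>)
    then show "poly ?p x = poly (monom 1 (l - 1)) x"
      using I d by (simp add: poly_monom)
  next
    have c: "card (y ` I) = card I" using I by (simp add: card_image)
    show "degree ?p < card (y ` I)"
      unfolding c using I k
      by (intro degree_sum_less)
         (auto intro!: le_less_trans[OF degree_smult_le] degree_lagrange_poly)
    show "degree (monom (1 :: 'b) (l - 1)) < card (y ` I)"
      unfolding c using l by (auto simp: degree_monom_eq)
  qed
  moreover have "(\<Sum>c\<in>I. vandermonde_inv I y k c * y c ^ l) = coeff ?p (k - 1)"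
    unfolding coeff_sum
  proof (rule sum.cong)
    fix c assume "c \<in> I"
    moreover obtain m where "l = Suc m" using l by (cases l) auto
    ultimately show "vandermonde_inv I y k c * y c ^ l
        = coeff (smult (y c ^ (l - 1)) (lagrange_poly I y c)) (k - 1)"
      using I by (simp add: vandermonde_inv_def)
  qed simp
  ultimately show ?thesis
    using k l by (simp add: coeff_monom) arith
qed

text \<open>
  Summing over the coefficients evaluates the Lagrange polynomial of one node at another node.
\<close>
lemma vandermonde_inv_right:
  assumes I: "finite I" "inj_on y I" "\<And>c. c \<in> I \<Longrightarrow> y c \<noteq> 0"
    and c: "c \<in> I" and d: "d \<in> I"
  shows "(\<Sum>k=1..card I. y c ^ k * vandermonde_inv I y k d) = (if c = d then 1 else 0)"
proof -
  let ?p = "lagrange_poly I y d"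
  have "(\<Sum>k=1..card I. y c ^ k * vandermonde_inv I y k d)
      = (\<Sum>k<card I. y c / y d * (coeff ?p k * y c ^ k))"
    by (rule sum.reindex_bij_witness[where i = Suc and j = "\<lambda>k. k - 1"])
       (auto simp: vandermonde_inv_def simp flip: power_Suc)
  also have "\<dots> = y c / y d * (\<Sum>k<card I. coeff ?p k * y c ^ k)"
    by (simp add: sum_distrib_left)
  also have "(\<Sum>k<card I. coeff ?p k * y c ^ k) = poly ?p (y c)"
    unfolding poly_altdef
    by (rule sum.mono_neutral_right)
       (use degree_lagrange_poly[of I d y] I d in \<open>auto simp: not_le coeff_eq_0\<close>)
  finally show ?thesis
    using assms by (auto simp: poly_lagrange_poly)
qed

section \<open>Linear maps as matrices\<close>

text \<open>
  \<open>M w u\<close> is the coefficient of \<open>w\<close> in the image of \<open>u\<close>, so that composition is the usual matrix product.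
\<close>
definition of_matrix :: "'u set \<Rightarrow> ('u \<Rightarrow> 'u \<Rightarrow> 'b :: field) \<Rightarrow> ('u, 'u, 'b) lmap" where
  "of_matrix I M u = (if u \<in> I then \<Sum>w\<in>I. Poly_Mapping.single w (M w u) else 0)"

lemma lookup_of_matrix:
  "finite I \<Longrightarrow>
    Poly_Mapping.lookup (of_matrix I M u) w = (if u \<in> I \<and> w \<in> I then M w u else 0)"
  by (auto simp: of_matrix_def lookup_sum lookup_single when_def)

lemma eq_of_matrixI:
  assumes "finite I"
    and "\<And>u w. u \<in> I \<Longrightarrow> w \<in> I \<Longrightarrow> Poly_Mapping.lookup (f u) w = M w u"
    and "\<And>u w. u \<in> I \<Longrightarrow> w \<notin> I \<Longrightarrow> Poly_Mapping.lookup (f u) w = 0"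
    and "\<And>u. u \<notin> I \<Longrightarrow> f u = 0"
  shows "f = of_matrix I M"
proof (rule ext, rule poly_mapping_eqI)
  fix u w
  show "Poly_Mapping.lookup (f u) w = Poly_Mapping.lookup (of_matrix I M u) w"
    using assms(2-4)[of u] by (cases "u \<in> I"; cases "w \<in> I") (simp_all add: assms(1) lookup_of_matrix)
qed

lemma of_matrix_cong:
  "(\<And>u w. u \<in> I \<Longrightarrow> w \<in> I \<Longrightarrow> M w u = N w u) \<Longrightarrow> of_matrix I M = of_matrix I N"
  by (rule ext) (auto simp: of_matrix_def intro!: sum.cong)

lemma of_matrix_in_lmaps:
  "finite I \<Longrightarrow> (\<And>u w. u \<in> I \<Longrightarrow> w \<in> I \<Longrightarrow> M w u \<in> S) \<Longrightarrow> of_matrix I M \<in> lmaps S I I"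
  by (auto simp: lmaps_def lookup_of_matrix in_keys_iff split: if_splits) (simp add: of_matrix_def)

lemma idmap_eq_of_matrix:
  "finite I \<Longrightarrow> idmap I = of_matrix I (\<lambda>w u. if w = u then 1 else 0)"
  by (rule eq_of_matrixI) (auto simp: idmap_def lookup_single when_def)

lemma lookup_lcomp_superset:
  assumes "finite V" "Poly_Mapping.keys (g u) \<subseteq> V"
  shows "Poly_Mapping.lookup ((f \<odot> g) u) w
    = (\<Sum>v\<in>V. Poly_Mapping.lookup (f v) w * Poly_Mapping.lookup (g u) v)"
proof -
  have "Poly_Mapping.lookup ((f \<odot> g) u) w
      = (\<Sum>v\<in>Poly_Mapping.keys (g u). Poly_Mapping.lookup (f v) w * Poly_Mapping.lookup (g u) v)"
    by (simp add: lcomp_def lookup_sum map.rep_eq when_def) (rule sum.cong, auto)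
  also have "\<dots> = (\<Sum>v\<in>V. Poly_Mapping.lookup (f v) w * Poly_Mapping.lookup (g u) v)"
    by (rule sum.mono_neutral_left) (use assms in \<open>auto simp: in_keys_iff\<close>)
  finally show ?thesis .
qed

text \<open>
  The sums in a composition run over supports, which differ on the two sides.  Both are
  extended to one finite set that contains every support involved, and then exchanged.
\<close>
lemma lcomp_assoc: "f \<odot> g \<odot> h = f \<odot> (g \<odot> h)"
proof (rule ext, rule poly_mapping_eqI)
  fix u w
  let ?X = "Poly_Mapping.keys (h u)"
  let ?V = "(\<Union>x\<in>?X. Poly_Mapping.keys (g x)) \<union> Poly_Mapping.keys ((g \<odot> h) u)"
  have lk: "Poly_Mapping.lookup ((k \<odot> h) u) w
      = (\<Sum>x\<in>?X. Poly_Mapping.lookup (k x) w * Poly_Mapping.lookup (h u) x)" for k w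
    by (rule lookup_lcomp_superset) auto
  have "Poly_Mapping.lookup ((f \<odot> g \<odot> h) u) w
      = (\<Sum>x\<in>?X. \<Sum>v\<in>?V. Poly_Mapping.lookup (f v) w *
          (Poly_Mapping.lookup (g x) v * Poly_Mapping.lookup (h u) x))"
    unfolding lk
  proof (rule sum.cong[OF refl])
    fix x assume "x \<in> ?X"
    then have "Poly_Mapping.lookup ((f \<odot> g) x) w
        = (\<Sum>v\<in>?V. Poly_Mapping.lookup (f v) w * Poly_Mapping.lookup (g x) v)"
      by (intro lookup_lcomp_superset) auto
    then show "Poly_Mapping.lookup ((f \<odot> g) x) w * Poly_Mapping.lookup (h u) x
        = (\<Sum>v\<in>?V. Poly_Mapping.lookup (f v) w *
            (Poly_Mapping.lookup (g x) v * Poly_Mapping.lookup (h u) x))"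
      by (simp only: sum_distrib_right mult.assoc)
  qed
  also have "\<dots> = (\<Sum>v\<in>?V. Poly_Mapping.lookup (f v) w * Poly_Mapping.lookup ((g \<odot> h) u) v)"
    by (subst sum.swap)
       (simp only: lk sum_distrib_left)
  also have "\<dots> = Poly_Mapping.lookup ((f \<odot> (g \<odot> h)) u) w"
    by (rule lookup_lcomp_superset[symmetric]) auto
  finally show "Poly_Mapping.lookup ((f \<odot> g \<odot> h) u) w
      = Poly_Mapping.lookup ((f \<odot> (g \<odot> h)) u) w" .
qed

lemma of_matrix_lcomp:
  assumes "finite I"
  shows "of_matrix I M \<odot> of_matrix I N = of_matrix I (\<lambda>w u. \<Sum>v\<in>I. M w v * N v u)"
proof (rule eq_of_matrixI)
  fix u w
  assume u: "u \<in> I"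
  have "Poly_Mapping.keys (of_matrix I N u) \<subseteq> I"
    using assms by (auto simp: in_keys_iff lookup_of_matrix split: if_splits)
  note lk = lookup_lcomp_superset[of I "of_matrix I N" u "of_matrix I M" w, OF assms this]
  show "Poly_Mapping.lookup ((of_matrix I M \<odot> of_matrix I N) u) w = (\<Sum>v\<in>I. M w v * N v u)" if "w \<in> I"
    using assms u that by (simp add: lk lookup_of_matrix)
  show "Poly_Mapping.lookup ((of_matrix I M \<odot> of_matrix I N) u) w = 0" if "w \<notin> I"
    using assms u that by (simp add: lk lookup_of_matrix)
qed (use assms in \<open>auto simp: lcomp_def of_matrix_def\<close>)

lemma lmaps_eq_of_matrix:
  assumes "finite I" "f \<in> lmaps S I I"
  shows "f = of_matrix I (\<lambda>w u. Poly_Mapping.lookup (f u) w)"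
  by (intro eq_of_matrixI[OF assms(1)])
     (use assms(2) in \<open>auto simp: lmaps_def simp flip: not_in_keys_iff_lookup_eq_zero\<close>)

lemma lcomp_idmap:
  assumes "finite I"
  shows "of_matrix I M \<odot> idmap I = of_matrix I M" "idmap I \<odot> of_matrix I M = of_matrix I M"
  using assms
  by (auto simp: idmap_eq_of_matrix of_matrix_lcomp intro!: of_matrix_cong
      simp flip: of_bool_def)

text \<open>
  The inverse is described by \<open>THE\<close>; exhibiting one two-sided inverse determines it by associativity.
\<close>
lemma invertible_mapI:
  assumes I: "finite I" and f: "f \<in> lmaps S I I" and g: "is_inverse S I f g"
  shows "invertible_map S I f" "inv_map S I f = g"
proof -
  show "invertible_map S I f" using f g by (auto simp: invertible_map_def)
  show "inv_map S I f = g"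
    unfolding inv_map_def
  proof (rule the_equality, rule g)
    fix g' assume g': "is_inverse S I f g'"
    note m = lmaps_eq_of_matrix[OF I]
    have "g' = g' \<odot> (f \<odot> g)"
      using g' g I by (metis is_inverse_def m lcomp_idmap(1))
    also have "\<dots> = g"
      using g' g I by (metis is_inverse_def m lcomp_idmap(2) lcomp_assoc)
    finally show "g' = g" .
  qed
qed

section \<open>The group algebra and its fractions\<close>

lemma fracs_subfield:
  assumes zero: "0 \<in> L" and add: "\<And>\<kappa> \<mu>. \<kappa> \<in> L \<Longrightarrow> \<mu> \<in> L \<Longrightarrow> \<kappa> + \<mu> \<in> L"
  shows "subfield (fracs L :: 'f :: field ffield set)"
proof -
  have alg: "0 \<in> group_algebra L" "1 \<in> group_algebra L"
    "a \<in> group_algebra L \<Longrightarrow> b \<in> group_algebra L \<Longrightarrow> a - b \<in> group_algebra L"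
    "a \<in> group_algebra L \<Longrightarrow> b \<in> group_algebra L \<Longrightarrow> a * b \<in> group_algebra L"
    for a b :: "'f galg"
  proof -
    show "0 \<in> group_algebra L" "1 \<in> group_algebra L"
      using zero by (auto simp: group_algebra_def)
    assume ab: "a \<in> group_algebra L" "b \<in> group_algebra L"
    then show "a - b \<in> group_algebra L"
      using keys_diff[of a b] by (auto simp: group_algebra_def)
    show "a * b \<in> group_algebra L"
      using ab keys_mult[of a b] add by (fastforce simp: group_algebra_def)
  qed
  have I: "Fract a b \<in> fracs L" if "a \<in> group_algebra L" "b \<in> group_algebra L" "b \<noteq> 0" for a b :: "'f galg"
    using that by (auto simp: fracs_def)
  show ?thesis
  proof
    fix x y :: "'f ffield"
    show zero: "0 \<in> (fracs L :: 'f ffield set)" and "1 \<in> (fracs L :: 'f ffield set)"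
      by (auto simp: Zero_fract_def One_fract_def intro!: I alg)
    assume x: "x \<in> fracs L"
    then obtain a b where ab: "x = Fract a b" "a \<in> group_algebra L" "b \<in> group_algebra L" "b \<noteq> 0"
      by (auto simp: fracs_def)
    show "inverse x \<in> fracs L"
    proof (cases "a = 0")
      case True
      then show ?thesis using ab zero by (simp add: fract_collapse)
    next
      case False
      then show ?thesis using ab by (simp add: I)
    qed
    assume "y \<in> fracs L"
    then obtain c d where cd: "y = Fract c d" "c \<in> group_algebra L" "d \<in> group_algebra L" "d \<noteq> 0"
      by (auto simp: fracs_def)
    show "x - y \<in> fracs L" "x * y \<in> fracs L"
      using ab cd by (auto intro!: I alg)
  qed
qed

lemma K_in_fracs: "0 \<in> L \<Longrightarrow> \<mu> \<in> L \<Longrightarrow> K \<mu> \<in> fracs L"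
  by (force simp: K_def fracs_def group_algebra_def intro: exI[of _ 1])

lemma scal_in_fracs: "0 \<in> L \<Longrightarrow> scal c \<in> fracs L"
  by (force simp: scal_def fracs_def group_algebra_def intro: exI[of _ 1] split: if_splits)

interpretation B_field: subfield "B_field n"
  unfolding B_field_def root_lattice_def by (intro fracs_subfield group_closure_add) simp_all

interpretation B_ext: subfield "B_ext n"
  unfolding B_ext_def ext_lattice_def by (intro fracs_subfield group_closure_add) simp_all

lemma K_0: "K 0 = 1"
  by (simp add: K_def One_fract_def)

lemma K_add: "K (\<kappa> + \<mu>) = K \<kappa> * K \<mu>"
  by (simp add: K_def mult_single)

lemma K_uminus: "K (- \<mu>) = inverse (K \<mu>)"
proof -
  have "K \<mu> * K (- \<mu>) = 1" by (simp flip: K_add add: K_0)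
  then show ?thesis by (metis inverse_unique)
qed

lemma K_of_nat_mult: "K (of_nat k * \<mu>) = K \<mu> ^ k"
  by (induction k) (simp_all add: K_0 K_add algebra_simps)

lemma K_nonzero: "K \<mu> \<noteq> 0"
  by (simp add: K_def Zero_fract_def eq_fract) (metis lookup_single_eq lookup_zero one_neq_zero)

lemma scal_eq_iff: "scal a = scal b \<longleftrightarrow> a = b"
  by (simp add: scal_def eq_fract) (metis lookup_single_eq)

lemma scal_0: "scal 0 = 0"
  by (simp add: scal_def Zero_fract_def)

lemma scal_1: "scal 1 = 1"
  by (simp add: scal_def One_fract_def)

lemma scal_add: "scal (a + b) = scal a + scal b"
  by (simp add: scal_def single_add)

lemma scal_diff: "scal (a - b) = scal a - scal b"
  by (simp add: scal_def single_diff)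

lemma scal_mult: "scal (a * b) = scal a * scal b"
  by (simp add: scal_def mult_single)

lemma scal_inverse: "scal (inverse a) = inverse (scal a)"
proof (cases "a = 0")
  case False
  have "scal a * scal (inverse a) = 1"
    using False by (simp add: scal_1 flip: scal_mult)
  then show ?thesis by (metis inverse_unique)
qed (simp add: scal_0)

lemma scal_power: "scal (a ^ k) = scal a ^ k"
  by (induction k) (simp_all add: scal_1 scal_mult)

lemma scal_of_nat: "scal (of_nat m) = of_nat m"
  by (induction m) (simp_all add: scal_0 scal_1 scal_add)

lemma scal_of_int: "scal (of_int k) = of_int k"
  by (cases k rule: int_diff_cases) (simp add: scal_diff scal_of_nat)

text \<open>
  Distinct weights give linearly independent \<open>K\<^sub>\<mu>\<close>.  This is what separates the nodes of the Vandermonde matrices.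
\<close>
lemma scal_mult_K_eq:
  assumes "scal a * K \<kappa> = scal b * K \<mu>" "a \<noteq> 0"
  shows "\<kappa> = \<mu>"
proof -
  have "Poly_Mapping.single \<kappa> a = Poly_Mapping.single \<mu> b"
    using assms by (simp add: scal_def K_def mult_single eq_fract)
  then show ?thesis using assms(2) by (metis lookup_single_eq lookup_single_not_eq)
qed

lemma lookup_nu:
  "Poly_Mapping.lookup (nu n i) k
    = (if k = i then 1 else 0) - (if k \<in> {1..n} then 1 / of_nat n else 0)"
  by (auto simp: nu_def lookup_minus lookup_sum lookup_single when_def)

lemma nu_eq_iff: "nu n i = nu n j \<longleftrightarrow> i = j"
proof
  assume "nu n i = nu n j"
  then have "Poly_Mapping.lookup (nu n i) i = Poly_Mapping.lookup (nu n j) i" by simp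
  then show "i = j" by (auto simp: lookup_nu split: if_splits)
qed simp

section \<open>The action of the torus\<close>

lemma pairing_add: "pairing \<kappa> (\<mu> + \<mu>') = pairing \<kappa> \<mu> + pairing \<kappa> \<mu>'"
  by (simp add: pairing_def lookup_add algebra_simps sum.distrib)

lemma pairing_0: "pairing \<kappa> 0 = 0"
  by (simp add: pairing_def)

lemma pairing_uminus: "pairing \<kappa> (- \<mu>) = - pairing \<kappa> \<mu>"
  using pairing_add[of \<kappa> \<mu> "- \<mu>"] by (simp add: pairing_0)

lemma pairing_of_nat_mult: "pairing \<kappa> (of_nat k * \<mu>) = of_nat k * pairing \<kappa> \<mu>"
  by (induction k) (simp_all add: pairing_0 pairing_add algebra_simps)

lemma qpow_nonzero: "q \<noteq> 0 \<Longrightarrow> r \<noteq> 0 \<Longrightarrow> qpow n q r x \<noteq> 0"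
  by (simp add: qpow_def)

text \<open>
  For arbitrary rational exponents \<open>qpow\<close> is not additive, since it distinguishes two cases.
  Adding an element of \<open>(2/n)\<int>\<close> respects the case distinction, and one such summand is all that
  evaluating the action on \<open>K\<^sub>\<mu>\<close> requires.
\<close>
lemma qpow_add_root:
  assumes "n \<noteq> 0" "r \<noteq> 0"
  shows "qpow n q r (2 * of_int k / of_nat n + x) = r powi k * qpow n q r x"
proof -
  have "of_nat n * (2 * of_int k / of_nat n + y) / 2 = of_int k + of_nat n * y / (2 :: rat)" for y
    using assms by (simp add: field_simps)
  moreover have "2 * of_int k / of_nat n + x - 1 = 2 * of_int k / of_nat n + (x - 1)"
    by simp
  moreover have "of_int k + y \<in> \<int> \<longleftrightarrow> y \<in> \<int>" for y :: rat
    using Ints_add[of "of_int k" y] Ints_diff[of "of_int k + y" "of_int k"] by auto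
  ultimately show ?thesis
    using assms by (simp only: qpow_def floor_add_int[symmetric] add.commute[of _ "of_int k"])
      (simp add: power_int_add)
qed

lemma lookup_twist:
  "Poly_Mapping.lookup (twist n q r \<kappa> a) \<mu> = qpow n q r (pairing \<kappa> \<mu>) * Poly_Mapping.lookup a \<mu>"
  by (simp add: twist_def lookup_mapp when_def in_keys_iff)

lemma lookup_single_mult:
  "Poly_Mapping.lookup (Poly_Mapping.single \<mu> c * a) \<omega> = c * Poly_Mapping.lookup a (\<omega> - \<mu>)"
  for \<mu> :: "'a :: ab_group_add" and c :: "'b :: comm_ring_1"
proof -
  have eq: "\<omega> = \<kappa> + \<kappa>' \<longleftrightarrow> \<kappa>' = \<omega> - \<kappa>" for \<kappa> \<kappa>' by (auto simp: algebra_simps)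
  show ?thesis
    by (simp add: lookup_mult lookup_single eq when_mult)
qed

text \<open>
  The value must not depend on how \<open>K\<^sub>\<mu>\<close> is written as \<open>x / y\<close>.  Any such fraction has
  \<open>x = K\<^sub>\<mu> y\<close>, and twisting this product multiplies the twist of \<open>y\<close> by \<open>r\<^sup>k K\<^sub>\<mu>\<close> because \<open>(\<kappa>, \<mu>) \<in> (2/n)\<int>\<close>;
  moreover twisting never annihilates \<open>y\<close>.
\<close>
lemma shift_K:
  assumes n: "n \<noteq> 0" and q: "q \<noteq> 0" and r: "r \<noteq> 0"
    and \<mu>: "\<mu> \<in> ext_lattice n" and k: "pairing \<kappa> \<mu> = 2 * of_int k / of_nat n"
  shows "shift n q r \<kappa> (K \<mu>) = scal (r powi k) * K \<mu>"
proof -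
  have twist_mult: "twist n q r \<kappa> (Poly_Mapping.single \<mu> 1 * y)
      = Poly_Mapping.single \<mu> (r powi k) * twist n q r \<kappa> y" for y
  proof (rule poly_mapping_eqI)
    fix \<omega>
    have "pairing \<kappa> \<omega> = 2 * of_int k / of_nat n + pairing \<kappa> (\<omega> - \<mu>)"
      using pairing_add[of \<kappa> \<mu> "\<omega> - \<mu>"] by (simp add: k)
    then show "Poly_Mapping.lookup (twist n q r \<kappa> (Poly_Mapping.single \<mu> 1 * y)) \<omega>
        = Poly_Mapping.lookup (Poly_Mapping.single \<mu> (r powi k) * twist n q r \<kappa> y) \<omega>"
      using n r by (simp add: lookup_twist lookup_single_mult qpow_add_root)
  qed
  have twist_nonzero: "twist n q r \<kappa> y \<noteq> 0" if y: "y \<noteq> 0" for y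
  proof
    assume z: "twist n q r \<kappa> y = 0"
    have "y = 0"
      by (rule poly_mapping_eqI)
         (use lookup_twist[of n q r \<kappa> y] z qpow_nonzero[OF q r] in \<open>auto simp: z\<close>)
    then show False using y by simp
  qed
  have fract: "Fract (twist n q r \<kappa> x) (twist n q r \<kappa> y) = scal (r powi k) * K \<mu>"
    if "y \<noteq> 0" "K \<mu> = Fract x y" for x y
  proof -
    have "x = Poly_Mapping.single \<mu> 1 * y"
      using that by (simp add: K_def eq_fract)
    then show ?thesis
      using twist_nonzero[OF that(1)]
      by (simp add: twist_mult scal_def K_def mult_single eq_fract)
  qed
  show ?thesis
    unfolding shift_def
  proof (rule the_equality)
    let ?G = "group_algebra (ext_lattice n)"
    have 1: "Poly_Mapping.single \<mu> 1 \<in> ?G" "1 \<in> ?G"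
      using \<mu> by (auto simp: group_algebra_def ext_lattice_def)
    show "\<exists>x\<in>?G. \<exists>y\<in>?G. y \<noteq> 0 \<and> K \<mu> = Fract x y
        \<and> scal (r powi k) * K \<mu> = Fract (twist n q r \<kappa> x) (twist n q r \<kappa> y)"
      using fract[of 1 "Poly_Mapping.single \<mu> 1"]
      by (intro bexI[OF _ 1(1)] bexI[OF _ 1(2)]) (simp add: K_def)
  qed (use fract in auto)
qed

section \<open>The gauge matrices\<close>

text \<open>
  \<open>K\<^bsub>\<nu>\<^sub>c\<^esub>\<^bsup>-2\<^esup>\<close>, written so that its exponent is visibly in \<open>Q + 2P\<close>.
\<close>
definition node :: "nat \<Rightarrow> nat \<Rightarrow> ('f :: field) ffield" where
  "node n c = K (- (nu n c + nu n c))"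

text \<open>
  The result of acting on \<open>node n c\<close> by the weight of \<open>e\<^sub>d\<close>, without the factor \<open>r\<close>.  That factor does
  not depend on \<open>c\<close> and \<open>d\<close>, and leaving it out makes the remaining quantities comparable with \<open>R\<close>.
\<close>
definition shifted_node :: "nat \<Rightarrow> 'f :: field \<Rightarrow> nat \<Rightarrow> nat \<Rightarrow> 'f ffield" where
  "shifted_node n q d c = scal (if c = d then inverse (q\<^sup>2) else 1) * node n c"

lemma K_nu_powi: "K (nu n a) powi (- 2 * int i) = node n a ^ i"
proof -
  have node: "node n a = K (nu n a) powi (- 2)"
    by (simp only: node_def K_uminus K_add) (simp add: power_int_minus power2_eq_square)
  show ?thesis unfolding node by (simp only: power_int_mult power_int_of_nat)
qed

lemma node_nonzero: "node n c \<noteq> 0"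
  by (simp add: node_def K_nonzero)

lemma shifted_node_nonzero: "q \<noteq> 0 \<Longrightarrow> shifted_node n q d c \<noteq> 0"
  using scal_eq_iff[of "inverse (q\<^sup>2)" 0]
  by (auto simp: shifted_node_def node_nonzero scal_0 scal_1)

lemma weight_double_eq_iff: "\<kappa> + \<kappa> = \<mu> + \<mu> \<longleftrightarrow> \<kappa> = \<mu>" for \<kappa> \<mu> :: weight
proof
  assume eq: "\<kappa> + \<kappa> = \<mu> + \<mu>"
  show "\<kappa> = \<mu>"
  proof (rule poly_mapping_eqI)
    fix k
    from arg_cong[OF eq, of "\<lambda>x. Poly_Mapping.lookup x k"]
    show "Poly_Mapping.lookup \<kappa> k = Poly_Mapping.lookup \<mu> k"
      unfolding lookup_add by linarith
  qed
qed simp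

lemma scal_mult_node_eq:
  assumes "scal a * node n c = scal b * node n d" "a \<noteq> 0"
  shows "c = d"
  using scal_mult_K_eq[OF assms[unfolded node_def]]
  by (metis neg_equal_iff_equal weight_double_eq_iff nu_eq_iff)

lemma inj_on_node: "inj_on (node n) I"
  using scal_mult_node_eq[of 1 n _ 1] by (auto simp: inj_on_def scal_1)

lemma inj_on_shifted_node: "q \<noteq> 0 \<Longrightarrow> inj_on (shifted_node n q d) I"
  by (rule inj_onI) (unfold shifted_node_def, erule scal_mult_node_eq, simp)

lemma double_nu_in_ext_lattice:
  assumes "c \<in> {1..n}"
  shows "- (nu n c + nu n c) \<in> ext_lattice n"
proof -
  have "nu n c \<in> weight_lattice n"
    unfolding weight_lattice_def using assms by (intro group_closure.base) auto
  then show ?thesis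
    unfolding ext_lattice_def by (auto intro!: group_closure.base)
qed

lemma node_in_B_ext: "c \<in> {1..n} \<Longrightarrow> node n c \<in> B_ext n"
  unfolding node_def B_ext_def
  by (rule K_in_fracs[OF _ double_nu_in_ext_lattice]) (simp_all add: ext_lattice_def)

lemma scal_in_B_ext: "scal c \<in> B_ext n"
  unfolding B_ext_def by (rule scal_in_fracs) (simp add: ext_lattice_def)

text \<open>
  The exponent is \<open>(\<nu>\<^sub>d, -2i\<nu>\<^sub>c) = 2i(1 - n\<delta>)/n\<close> with \<open>\<delta> = \<delta>\<^sub>c\<^sub>d\<close>, and \<open>r\<^bsup>1-n\<delta>\<^esup> = r q\<^bsup>-2\<delta>\<^esup>\<close>.
\<close>
lemma shift_node_power:
  assumes "q \<noteq> 0" "r ^ n = q\<^sup>2" "c \<in> {1..n}" "d \<in> {1..n}"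
  shows "shift n q r (nu n d) (node n c ^ i) = (scal r * shifted_node n q d c) ^ i"
proof -
  let ?m = "if c = d then 1 - int n else 1"
  have n: "n \<noteq> 0" and r: "r \<noteq> 0" using assms by (auto simp: power_0_left)
  have "pairing (nu n d) (of_nat i * (- (nu n c + nu n c))) = 2 * of_int (int i * ?m) / of_nat n"
    using assms(3,4) n
    by (simp only: pairing_of_nat_mult pairing_uminus pairing_add pairing_nu)
       (simp add: field_simps)
  from shift_K[OF n assms(1) r group_closure_scalar_mult_left[OF
      double_nu_in_ext_lattice[OF assms(3), unfolded ext_lattice_def], folded ext_lattice_def] this]
  have "shift n q r (nu n d) (node n c ^ i) = scal (r powi (int i * ?m)) * node n c ^ i"
    by (simp only: K_of_nat_mult node_def)
  also have "r powi (int i * ?m) = (r powi ?m) ^ i"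
    by (simp only: mult.commute[of "int i"] power_int_mult power_int_of_nat)
  also have "r powi ?m = r * (if c = d then inverse (q\<^sup>2) else 1)"
    using r by (simp add: power_int_diff assms(2) field_simps)
  finally show ?thesis
    by (simp add: shifted_node_def scal_power scal_mult power_mult_distrib)
qed

lemma lookup_A_op:
  "Poly_Mapping.lookup (A_op n i) a = (if i \<in> {1..n} \<and> a \<in> {1..n} then node n a ^ i else 0)"
  by (auto simp: A_op_def V_basis_def K_nu_powi lookup_sum lookup_single when_def
      simp del: mult_minus_left)

lemma keys_A_op: "Poly_Mapping.keys (A_op n i :: nat \<Rightarrow>\<^sub>0 'f :: field ffield) = (if i \<in> {1..n} then {1..n} else {})"
  by (rule set_eqI) (auto simp: in_keys_iff lookup_A_op node_nonzero)

lemma tau_coact_V: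
  assumes "d \<in> {1..n}"
  shows "tau n (q :: 'f :: field) r (coact_V n) b d = Poly_Mapping.single d (shift n q r (nu n d) b)"
proof -
  have "Poly_Mapping.single (nu n d) (1 :: 'f) \<noteq> 0"
    by (metis lookup_single_eq lookup_zero one_neq_zero)
  then show ?thesis
    using assms by (simp add: tau_def coact_V_def sigma_def scal_1)
qed

lemma sum_keys_single:
  "(\<Sum>d'\<in>Poly_Mapping.keys (Poly_Mapping.single d x).
      Poly_Mapping.single (c, d') (Poly_Mapping.lookup (Poly_Mapping.single d x) d' * y))
    = Poly_Mapping.single (c, d) (x * y)" for x :: "'b :: field"
  by simp

text \<open>
  The coaction of \<open>V\<close> is diagonal, so moving a coefficient past \<open>e\<^sub>d\<close> only applies the action of the
  weight \<open>\<nu>\<^sub>d\<close> to it.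
\<close>
lemma tensor_map_coact_V:
  assumes "Poly_Mapping.keys (g v) \<subseteq> {1..n}"
  shows "tensor_map n q r (coact_V n) f g (u, v)
    = (\<Sum>c\<in>Poly_Mapping.keys (f u). \<Sum>d\<in>Poly_Mapping.keys (g v). Poly_Mapping.single (c, d)
        (shift n q r (nu n d) (Poly_Mapping.lookup (f u) c) * Poly_Mapping.lookup (g v) d))"
  unfolding tensor_map_def prod.case
proof (intro sum.cong refl)
  fix c d
  assume "d \<in> Poly_Mapping.keys (g v)"
  then have d: "d \<in> {1..n}" using assms by blast
  show "(let t = tau n q r (coact_V n) (Poly_Mapping.lookup (f u) c) d in
      \<Sum>d'\<in>Poly_Mapping.keys t.
        Poly_Mapping.single (c, d') (Poly_Mapping.lookup t d' * Poly_Mapping.lookup (g v) d))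
    = Poly_Mapping.single (c, d)
        (shift n q r (nu n d) (Poly_Mapping.lookup (f u) c) * Poly_Mapping.lookup (g v) d)"
    unfolding tau_coact_V[OF d] Let_def sum_keys_single ..
qed

lemma finite_VV_basis: "finite (VV_basis n)"
  by (simp add: VV_basis_def V_basis_def)

lemma VV_basis_iff: "(i, j) \<in> VV_basis n \<longleftrightarrow> i \<in> {1..n} \<and> j \<in> {1..n}"
  by (simp add: VV_basis_def V_basis_def)

lemma sum_VV_basis: "(\<Sum>v\<in>VV_basis n. f v) = (\<Sum>a=1..n. \<Sum>b=1..n. f (a, b))"
  by (simp add: VV_basis_def V_basis_def sum.cartesian_product)

lemma A1_eq_of_matrix:
  assumes "q \<noteq> 0" "r ^ n = q\<^sup>2"
  shows "A1 n q r = of_matrix (VV_basis n) (\<lambda>(c, d) (i, j).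
    if d = j then (scal r * shifted_node n q d c) ^ i else 0)"
proof (rule eq_of_matrixI[OF finite_VV_basis])
  fix u :: "nat \<times> nat"
  obtain i j where u: "u = (i, j)" by force
  have A1: "A1 n q r u = (\<Sum>c\<in>Poly_Mapping.keys (A_op n i :: nat \<Rightarrow>\<^sub>0 'a ffield).
      \<Sum>d\<in>Poly_Mapping.keys (idmap (V_basis n) j :: nat \<Rightarrow>\<^sub>0 'a ffield).
        Poly_Mapping.single (c, d) (shift n q r (nu n d) (Poly_Mapping.lookup (A_op n i) c)
          * Poly_Mapping.lookup (idmap (V_basis n) j) d))"
    unfolding A1_def u by (rule tensor_map_coact_V) (auto simp: idmap_def V_basis_def)
  show "A1 n q r u = 0" if "u \<notin> VV_basis n"
    using that unfolding A1 by (auto simp: u VV_basis_iff idmap_def V_basis_def keys_A_op)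
  assume "u \<in> VV_basis n"
  then have ij: "i \<in> {1..n}" "j \<in> {1..n}" by (auto simp: u VV_basis_iff)
  have A1': "A1 n q r u
      = (\<Sum>c=1..n. Poly_Mapping.single (c, j) ((scal r * shifted_node n q j c) ^ i))"
    unfolding A1 using ij
    by (simp add: keys_A_op idmap_def V_basis_def lookup_A_op shift_node_power[OF assms])
  fix w :: "nat \<times> nat"
  obtain c d where w: "w = (c, d)" by force
  have lk: "Poly_Mapping.lookup (A1 n q r u) w
      = (if c \<in> {1..n} \<and> d = j then (scal r * shifted_node n q d c) ^ i else 0)"
    unfolding A1' w by (auto simp: lookup_sum lookup_single when_def)
  show "Poly_Mapping.lookup (A1 n q r u) w = (case w of (c, d) \<Rightarrow> \<lambda>(i, j).
      if d = j then (scal r * shifted_node n q d c) ^ i else 0) u" if "w \<in> VV_basis n"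
    using that by (simp add: lk) (simp add: u w VV_basis_iff)
  show "Poly_Mapping.lookup (A1 n q r u) w = 0" if "w \<notin> VV_basis n"
    using that ij by (simp only: lk) (auto simp: w VV_basis_iff)
qed

lemma A2_eq_of_matrix:
  assumes "q \<noteq> 0" "r ^ n = q\<^sup>2"
  shows "A2 n q r = of_matrix (VV_basis n) (\<lambda>(c, d) (i, j).
    if c = i then node n d ^ j else 0)"
proof (rule eq_of_matrixI[OF finite_VV_basis])
  fix u :: "nat \<times> nat"
  obtain i j where u: "u = (i, j)" by force
  have A2: "A2 n q r u = (\<Sum>c\<in>Poly_Mapping.keys (idmap (V_basis n) i :: nat \<Rightarrow>\<^sub>0 'a ffield).
      \<Sum>d\<in>Poly_Mapping.keys (A_op n j :: nat \<Rightarrow>\<^sub>0 'a ffield).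
        Poly_Mapping.single (c, d) (shift n q r (nu n d) (Poly_Mapping.lookup (idmap (V_basis n) i) c)
          * Poly_Mapping.lookup (A_op n j) d))"
    unfolding A2_def u by (rule tensor_map_coact_V) (simp add: keys_A_op)
  show "A2 n q r u = 0" if "u \<notin> VV_basis n"
    using that unfolding A2 by (auto simp: u VV_basis_iff idmap_def V_basis_def keys_A_op)
  assume "u \<in> VV_basis n"
  then have ij: "i \<in> {1..n}" "j \<in> {1..n}" by (auto simp: u VV_basis_iff)
  have shift_1: "shift n q r (nu n d) 1 = 1" if "d \<in> {1..n}" for d
    using shift_node_power[OF assms ij(1) that, of 0] by simp
  have A2': "A2 n q r u = (\<Sum>d=1..n. Poly_Mapping.single (i, d) (node n d ^ j))"
    unfolding A2 using ij
    by (simp add: keys_A_op idmap_def V_basis_def lookup_A_op shift_1)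
  fix w :: "nat \<times> nat"
  obtain c d where w: "w = (c, d)" by force
  have lk: "Poly_Mapping.lookup (A2 n q r u) w
      = (if d \<in> {1..n} \<and> c = i then node n d ^ j else 0)"
    unfolding A2' w by (auto simp: lookup_sum lookup_single when_def)
  show "Poly_Mapping.lookup (A2 n q r u) w = (case w of (c, d) \<Rightarrow> \<lambda>(i, j).
      if c = i then node n d ^ j else 0) u" if "w \<in> VV_basis n"
    using that by (simp add: lk) (simp add: u w VV_basis_iff)
  show "Poly_Mapping.lookup (A2 n q r u) w = 0" if "w \<notin> VV_basis n"
    using that ij by (simp only: lk) (auto simp: w VV_basis_iff)
qed

text \<open>
  \<open>A\<^sub>1\<close> leaves the second tensor factor alone and \<open>A\<^sub>2\<close> the first.  This lemma and the next one reduce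
  products of such block diagonal matrices, and so the inversion of \<open>A\<^sub>1\<close> and \<open>A\<^sub>2\<close>, to single blocks.
\<close>
lemma of_matrix_lcomp_block_snd:
  "of_matrix (VV_basis n) (\<lambda>(c, d) (i, j). if d = j then M d c i else 0)
    \<odot> of_matrix (VV_basis n) (\<lambda>(c, d) (i, j). if d = j then N d c i else 0)
    = of_matrix (VV_basis n) (\<lambda>(c, d) (i, j). if d = j then \<Sum>a=1..n. M d c a * N d a i else 0)"
proof -
  have "(\<Sum>b=1..n. (if d = b then M d c a else 0) * (if b = j then N b a i else 0))
      = (\<Sum>b=1..n. if b = d then (if d = j then M d c a * N d a i else 0) else 0)" for a c d i j
    by (rule sum.cong) auto
  then show ?thesis
    unfolding of_matrix_lcomp[OF finite_VV_basis]
    by (intro of_matrix_cong) (auto simp: sum_VV_basis VV_basis_iff)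
qed

lemma of_matrix_lcomp_block_fst:
  "of_matrix (VV_basis n) (\<lambda>(c, d) (i, j). if c = i then M c d j else 0)
    \<odot> of_matrix (VV_basis n) (\<lambda>(c, d) (i, j). if c = i then N c d j else 0)
    = of_matrix (VV_basis n) (\<lambda>(c, d) (i, j). if c = i then \<Sum>b=1..n. M c d b * N c b j else 0)"
proof -
  have "(\<Sum>a=1..n. \<Sum>b=1..n. (if c = a then M c d b else 0) * (if a = i then N a b j else 0))
      = (\<Sum>a=1..n. if a = c then (if c = i then \<Sum>b=1..n. M c d b * N c b j else 0) else 0)" for c d i j
    by (rule sum.cong) auto
  then show ?thesis
    unfolding of_matrix_lcomp[OF finite_VV_basis]
    by (intro of_matrix_cong) (auto simp: sum_VV_basis VV_basis_iff)
qed

lemma A1_invertible: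
  assumes "q \<noteq> 0" "r \<noteq> 0" "r ^ n = q\<^sup>2"
  shows "\<exists>g. is_inverse (B_ext n) (VV_basis n) (A1 n q r) g"
    and "A1 n q r \<in> lmaps (B_ext n) (VV_basis n) (VV_basis n)"
proof -
  let ?y = "\<lambda>d c. scal r * shifted_node n q d c"
  let ?N = "\<lambda>(i, j) (c, d). if j = d then vandermonde_inv {1..n} (?y j) i c else 0"
  have r: "scal r \<noteq> 0" using scal_eq_iff[of r 0] assms by (simp add: scal_0)
  have y: "inj_on (?y d) {1..n}" "?y d c \<noteq> 0" for d c
  proof -
    show "?y d c \<noteq> 0"
      using r shifted_node_nonzero[OF assms(1)] by simp
    show "inj_on (?y d) {1..n}"
      by (rule inj_onI)
         (use inj_on_shifted_node[OF assms(1), of n d "{1..n}"] r in \<open>simp add: inj_on_eq_iff\<close>)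
  qed
  have vdm: "k \<in> {1..n} \<Longrightarrow> l \<in> {1..n} \<Longrightarrow>
      (\<Sum>c=1..n. vandermonde_inv {1..n} (?y d) k c * ?y d c ^ l) = (if k = l then 1 else 0)"
    "k \<in> {1..n} \<Longrightarrow> l \<in> {1..n} \<Longrightarrow>
      (\<Sum>i=1..n. ?y d k ^ i * vandermonde_inv {1..n} (?y d) i l) = (if k = l then 1 else 0)" for d k l
    using vandermonde_inv_left[of "{1..n}" "?y d" k l] vandermonde_inv_right[of "{1..n}" "?y d" k l] y
    by simp_all
  note mat = A1_eq_of_matrix[OF assms(1,3)] of_matrix_lcomp_block_snd
      idmap_eq_of_matrix[OF finite_VV_basis]
  have yB: "?y d c \<in> B_ext n" if "c \<in> {1..n}" for d c
    unfolding shifted_node_def by (intro B_ext.mult scal_in_B_ext node_in_B_ext that)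
  then show "A1 n q r \<in> lmaps (B_ext n) (VV_basis n) (VV_basis n)"
    unfolding mat
    by (intro of_matrix_in_lmaps finite_VV_basis)
       (auto simp: VV_basis_iff intro!: B_ext.zero B_ext.power)
  have "of_matrix (VV_basis n) ?N \<in> lmaps (B_ext n) (VV_basis n) (VV_basis n)"
    using yB by (intro of_matrix_in_lmaps finite_VV_basis)
       (auto simp: VV_basis_iff intro!: B_ext.zero B_ext.vandermonde_inv_closed)
  moreover have "of_matrix (VV_basis n) ?N \<odot> A1 n q r = idmap (VV_basis n)"
    unfolding mat
    by (intro of_matrix_cong) (auto simp: VV_basis_iff vdm simp del: One_nat_def cong: if_cong split: if_splits)
  moreover have "A1 n q r \<odot> of_matrix (VV_basis n) ?N = idmap (VV_basis n)"
    unfolding mat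
    by (intro of_matrix_cong) (auto simp: VV_basis_iff vdm simp del: One_nat_def cong: if_cong split: if_splits)
  ultimately show "\<exists>g. is_inverse (B_ext n) (VV_basis n) (A1 n q r) g"
    unfolding is_inverse_def by blast
qed

lemma A2_invertible:
  assumes "q \<noteq> 0" "r ^ n = q\<^sup>2"
  shows "\<exists>g. is_inverse (B_ext n) (VV_basis n) (A2 n q r) g"
    and "A2 n q r \<in> lmaps (B_ext n) (VV_basis n) (VV_basis n)"
proof -
  let ?N = "\<lambda>(i, j) (c, d). if i = c then vandermonde_inv {1..n} (node n) j d else 0"
  have vdm: "k \<in> {1..n} \<Longrightarrow> l \<in> {1..n} \<Longrightarrow>
      (\<Sum>c=1..n. vandermonde_inv {1..n} (node n) k c * node n c ^ l) = (if k = l then 1 else 0)"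
    "k \<in> {1..n} \<Longrightarrow> l \<in> {1..n} \<Longrightarrow>
      (\<Sum>i=1..n. node n k ^ i * vandermonde_inv {1..n} (node n) i l) = (if k = l then 1 else 0)" for k l
    using vandermonde_inv_left[of "{1..n}" "node n" k l] vandermonde_inv_right[of "{1..n}" "node n" k l]
    by (simp_all add: inj_on_node node_nonzero)
  note mat = A2_eq_of_matrix[OF assms] of_matrix_lcomp_block_fst
      idmap_eq_of_matrix[OF finite_VV_basis]
  show "A2 n q r \<in> lmaps (B_ext n) (VV_basis n) (VV_basis n)"
    unfolding mat
    by (intro of_matrix_in_lmaps finite_VV_basis)
       (auto simp: VV_basis_iff intro!: B_ext.zero B_ext.power node_in_B_ext)
  have "of_matrix (VV_basis n) ?N \<in> lmaps (B_ext n) (VV_basis n) (VV_basis n)"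
    by (intro of_matrix_in_lmaps finite_VV_basis)
       (auto simp: VV_basis_iff intro!: B_ext.zero B_ext.vandermonde_inv_closed node_in_B_ext)
  moreover have "of_matrix (VV_basis n) ?N \<odot> A2 n q r = idmap (VV_basis n)"
    unfolding mat
    by (intro of_matrix_cong) (auto simp: VV_basis_iff vdm simp del: One_nat_def cong: if_cong split: if_splits)
  moreover have "A2 n q r \<odot> of_matrix (VV_basis n) ?N = idmap (VV_basis n)"
    unfolding mat
    by (intro of_matrix_cong) (auto simp: VV_basis_iff vdm simp del: One_nat_def cong: if_cong split: if_splits)
  ultimately show "\<exists>g. is_inverse (B_ext n) (VV_basis n) (A2 n q r) g"
    unfolding is_inverse_def by blast
qed

lemma A1_A2_eq_of_matrix:
  assumes "q \<noteq> 0" "r ^ n = q\<^sup>2"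
  shows "A1 n q r \<odot> A2 n q r = of_matrix (VV_basis n) (\<lambda>(c, d) (i, j).
    (scal r * shifted_node n q d c) ^ i * node n d ^ j)"
proof -
  let ?t = "\<lambda>d c. scal r * shifted_node n q d c"
  have "(\<Sum>a=1..n. \<Sum>b=1..n. (if d = b then ?t d c ^ a else 0) * (if a = i then node n b ^ j else 0))
      = ?t d c ^ i * node n d ^ j" if "d \<in> {1..n}" "i \<in> {1..n}" for c d i j
  proof -
    have "(\<Sum>a=1..n. \<Sum>b=1..n. (if d = b then ?t d c ^ a else 0) * (if a = i then node n b ^ j else 0))
        = (\<Sum>a=1..n. \<Sum>b=1..n. if b = d then (if a = i then ?t d c ^ i * node n d ^ j else 0) else 0)"
      by (intro sum.cong) auto
    then show ?thesis using that by simp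
  qed
  then show ?thesis
    unfolding A1_eq_of_matrix[OF assms] A2_eq_of_matrix[OF assms] of_matrix_lcomp[OF finite_VV_basis]
    by (intro of_matrix_cong) (auto simp: sum_VV_basis VV_basis_iff)
qed

section \<open>The two R-matrices\<close>

text \<open>
  The argument of both \<open>\<alpha>\<close> and \<open>\<beta>\<close> in row \<open>e\<^sub>c \<otimes> e\<^sub>d\<close> of \<open>R\<close>.  It is kept in terms of roots
  because this shows that it lies in \<open>B\<close>; the \<open>shifted_node\<close> and the \<open>node\<close> whose quotient it is need not.
\<close>
definition root_ratio :: "nat \<Rightarrow> 'f :: field \<Rightarrow> nat \<Rightarrow> nat \<Rightarrow> 'f ffield" where
  "root_ratio n q c d = (K (wt_root n d c) * (if c = d then inverse (scal q) else 1))\<^sup>2"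

lemma root_ratio_eq: "root_ratio n q c d = shifted_node n q d c / node n d"
proof -
  have root: "K (wt_root n d c) = K (nu n d) * inverse (K (nu n c))"
    unfolding wt_root_def diff_conv_add_uminus K_add K_uminus ..
  have node: "node n a = (inverse (K (nu n a)))\<^sup>2" for a
    unfolding node_def K_uminus K_add by (simp add: power2_eq_square)
  have "scal (if c = d then inverse (q\<^sup>2) else 1) = (if c = d then inverse (scal q) else 1)\<^sup>2"
    by (cases "c = d") (simp_all add: scal_inverse scal_power scal_1 power_inverse)
  then show ?thesis
    unfolding root_ratio_def shifted_node_def root node
    by (simp only: power_mult_distrib divide_inverse power_inverse inverse_inverse_eq mult_ac)
qed

lemma R_op_eq_of_matrix:
  "R_op n q = of_matrix (VV_basis n) (\<lambda>(c, d) (i, j).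
    (if c = i \<and> d = j then alpha_fun (scal q) (root_ratio n q c d) else 0)
    + (if c = j \<and> d = i then beta_fun (scal q) (root_ratio n q c d) else 0))"
proof (rule eq_of_matrixI[OF finite_VV_basis])
  fix u w :: "nat \<times> nat"
  obtain i j c d where uw: "u = (i, j)" "w = (c, d)" by (metis surj_pair)
  show "R_op n q u = 0" if "u \<notin> VV_basis n"
    using that by (simp add: R_op_def uw)
  assume u: "u \<in> VV_basis n"
  have "R_op n q u = Poly_Mapping.single (i, j) (alpha_fun (scal q) (root_ratio n q i j))
      + Poly_Mapping.single (j, i) (beta_fun (scal q) (root_ratio n q j i))"
    using u by (simp only: R_op_def uw prod.case if_True Let_def root_ratio_def eq_commute[of j i])
  then have lk: "Poly_Mapping.lookup (R_op n q u) w
      = (if c = i \<and> d = j then alpha_fun (scal q) (root_ratio n q i j) else 0)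
        + (if c = j \<and> d = i then beta_fun (scal q) (root_ratio n q j i) else 0)"
    by (simp only: lookup_add lookup_single when_def uw prod.inject eq_commute[of i c]
        eq_commute[of i d] eq_commute[of j c] eq_commute[of j d])
  show "Poly_Mapping.lookup (R_op n q u) w = (case w of (c, d) \<Rightarrow> \<lambda>(i, j).
      (if c = i \<and> d = j then alpha_fun (scal q) (root_ratio n q c d) else 0)
      + (if c = j \<and> d = i then beta_fun (scal q) (root_ratio n q c d) else 0)) u"
    unfolding lk unfolding uw prod.case by (intro arg_cong2[of _ _ _ _ plus]) (simp_all cong: if_cong)
  show "Poly_Mapping.lookup (R_op n q u) w = 0" if "w \<notin> VV_basis n"
  proof -
    have n: "\<not> (c = i \<and> d = j)" "\<not> (c = j \<and> d = i)"
      using that u unfolding uw VV_basis_iff by blast+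
    show ?thesis unfolding lk if_not_P[OF n(1)] if_not_P[OF n(2)] by (rule add_0)
  qed
qed

lemma eta_antisym: "eta i j k = - eta j i k"
  by (auto simp: eta_def)

lemma eta_nonzero_range:
  assumes "eta i j k \<noteq> 0" "i \<in> {1..n}" "j \<in> {1..n}"
  shows "i + j - k \<in> {1..n}"
  using assms by (auto simp: eta_def split: if_splits)

text \<open>
  When \<open>\<eta>(i,j,k) = 0\<close> the index \<open>i + j - k\<close> may leave the range of the basis, but then the
  coefficient vanishes; so the formula holds without restriction on the index.
\<close>
lemma rho_eq_of_matrix:
  "of_scalar_map (rho n q r) = of_matrix (VV_basis n) (\<lambda>(k, l) (i, j).
    (if k = j \<and> l = i then scal (q * r powi (int i - int j)) else 0)
    + (if l = i + j - k
       then scal ((q - inverse q) * r powi (int i - int k) * of_int (eta i j k)) else 0))"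
proof (rule eq_of_matrixI[OF finite_VV_basis])
  fix u w :: "nat \<times> nat"
  obtain i j k l where uw: "u = (i, j)" "w = (k, l)" by force
  show "of_scalar_map (rho n q r) u = 0" if "u \<notin> VV_basis n"
    using that by (intro poly_mapping_eqI) (simp add: of_scalar_map_def rho_def uw map.rep_eq)
  assume "u \<in> VV_basis n"
  then have ij: "i \<in> {1..n}" "j \<in> {1..n}" by (auto simp: uw VV_basis_iff)
  have "Poly_Mapping.lookup (of_scalar_map (rho n q r) u) w
      = scal (Poly_Mapping.lookup (rho n q r u) w)"
    by (simp add: of_scalar_map_def map.rep_eq when_def scal_0)
  also have "Poly_Mapping.lookup (rho n q r u) w
      = (if k = j \<and> l = i then q * r powi (int i - int j) else 0)
      + (\<Sum>k'=1..n. if k' = k \<and> l = i + j - k'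
          then (q - inverse q) * r powi (int i - int k') * of_int (eta i j k') else 0)"
    using ij by (auto simp: rho_def uw VV_basis_iff lookup_add lookup_sum lookup_single when_def
      intro!: sum.cong)
  also have "(\<Sum>k'=1..n. if k' = k \<and> l = i + j - k'
        then (q - inverse q) * r powi (int i - int k') * of_int (eta i j k') else 0)
      = (if k \<in> {1..n} \<and> l = i + j - k
         then (q - inverse q) * r powi (int i - int k) * of_int (eta i j k) else 0)"
    by (cases "l = i + j - k") (auto intro!: sum.neutral simp: sum.delta if_distrib cong: conj_cong)
  finally have lk: "Poly_Mapping.lookup (of_scalar_map (rho n q r) u) w
      = scal ((if k = j \<and> l = i then q * r powi (int i - int j) else 0)
        + (if k \<in> {1..n} \<and> l = i + j - k
           then (q - inverse q) * r powi (int i - int k) * of_int (eta i j k) else 0))" .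
  show "Poly_Mapping.lookup (of_scalar_map (rho n q r) u) w = (case w of (k, l) \<Rightarrow> \<lambda>(i, j).
      (if k = j \<and> l = i then scal (q * r powi (int i - int j)) else 0)
      + (if l = i + j - k
         then scal ((q - inverse q) * r powi (int i - int k) * of_int (eta i j k)) else 0)) u"
    if "w \<in> VV_basis n"
    using that unfolding lk by (auto simp: uw VV_basis_iff scal_add scal_0)
  show "Poly_Mapping.lookup (of_scalar_map (rho n q r) u) w = 0" if "w \<notin> VV_basis n"
    using that ij eta_nonzero_range[of i j k n] unfolding lk
    by (cases "eta i j k = 0") (auto simp: uw VV_basis_iff scal_0)
qed

text \<open>
  For \<open>i \<le> j\<close> the sum runs over \<open>i \<le> k < j\<close>, and \<open>(y - x) x\<^sup>k y\<^bsup>i+j-k\<^esup>\<close> is \<open>y\<close> times the difference of the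
  consecutive terms \<open>x\<^sup>k y\<^bsup>i+j-k\<^esup>\<close> and \<open>x\<^bsup>k+1\<^esup> y\<^bsup>i+j-k-1\<^esup>\<close>.  Exchanging \<open>i\<close> and \<open>j\<close> changes both sides by a sign.
\<close>
lemma eta_sum_telescope:
  fixes x y :: "'b :: comm_ring_1"
  assumes "i \<in> {1..n}" "j \<in> {1..n}"
  shows "(y - x) * (\<Sum>k=1..n. of_int (eta i j k) * (x ^ k * y ^ (i + j - k)))
    = y * (x ^ i * y ^ j - x ^ j * y ^ i)"
proof -
  have le: "(y - x) * (\<Sum>k=1..n. of_int (eta i j k) * (x ^ k * y ^ (i + j - k)))
    = y * (x ^ i * y ^ j - x ^ j * y ^ i)" if "i \<in> {1..n}" "j \<in> {1..n}" "i \<le> j" for i j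
  proof -
    let ?F = "\<lambda>k. x ^ k * y ^ (i + j - k)"
    have "(\<Sum>k=1..n. of_int (eta i j k) * ?F k) = (\<Sum>k=i..<j. ?F k)"
      using that by (intro sum.mono_neutral_cong_right) (auto simp: eta_def)
    then have "(y - x) * (\<Sum>k=1..n. of_int (eta i j k) * ?F k) = (\<Sum>k=i..<j. (y - x) * ?F k)"
      by (simp add: sum_distrib_left)
    also have "\<dots> = (\<Sum>k=i..<j. y * (?F k - ?F (Suc k)))"
    proof (rule sum.cong)
      fix k assume "k \<in> {i..<j}"
      then have "i + j - k = Suc (i + j - Suc k)" by auto
      then show "(y - x) * ?F k = y * (?F k - ?F (Suc k))" by (simp add: algebra_simps)
    qed simp
    also have "\<dots> = y * (?F i - ?F j)"
      using sum_Suc_diff'[OF that(3), of "\<lambda>k. - ?F k"] by (simp flip: sum_distrib_left)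
    finally show ?thesis by simp
  qed
  show ?thesis
  proof (cases "i \<le> j")
    case False
    show ?thesis
    proof -
      have "(\<Sum>k=1..n. of_int (eta i j k) * (x ^ k * y ^ (i + j - k)))
          = - (\<Sum>k=1..n. of_int (eta j i k) * (x ^ k * y ^ (j + i - k)))"
        by (subst eta_antisym) (simp add: sum_negf add.commute)
      then show ?thesis
        using le[OF assms(2,1)] False by (simp add: algebra_simps)
    qed
  qed (rule le[OF assms])
qed

text \<open>
  The entry-wise form of the theorem.  Because \<open>\<beta> = p - \<alpha>\<close>, the left side is
  \<open>p x\<^sup>j y\<^sup>i + \<alpha> (x\<^sup>i y\<^sup>j - x\<^sup>j y\<^sup>i)\<close>, and \<open>\<alpha> = (p - p\<^bsup>-1\<^esup>) y / (y - x)\<close> turns the last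
  difference into the telescoping sum.
\<close>
lemma alpha_beta_eta:
  fixes p x y :: "'b :: field"
  assumes "y \<noteq> 0" "x \<noteq> y" "i \<in> {1..n}" "j \<in> {1..n}"
  shows "alpha_fun p (x / y) * (x ^ i * y ^ j) + beta_fun p (x / y) * (y ^ i * x ^ j)
    = p * (x ^ j * y ^ i)
      + (p - inverse p) * (\<Sum>k=1..n. of_int (eta i j k) * (x ^ k * y ^ (i + j - k)))"
proof -
  let ?\<alpha> = "alpha_fun p (x / y)"
  let ?S = "\<Sum>k=1..n. of_int (eta i j k) * (x ^ k * y ^ (i + j - k))"
  have xy: "1 - x / y \<noteq> 0" "y - x \<noteq> 0" using assms by (auto simp: field_simps)
  have alpha: "?\<alpha> = (p - inverse p) * (y / (y - x))"
    using assms xy by (simp add: alpha_fun_def divide_simps)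
  have beta: "beta_fun p (x / y) = p - ?\<alpha>"
    using xy(1) by (simp add: alpha_fun_def beta_fun_def field_simps)
  have "?\<alpha> * (x ^ i * y ^ j) + beta_fun p (x / y) * (y ^ i * x ^ j)
      = p * (x ^ j * y ^ i) + ?\<alpha> * (x ^ i * y ^ j - x ^ j * y ^ i)"
    unfolding beta by (simp add: algebra_simps)
  also have "?\<alpha> * (x ^ i * y ^ j - x ^ j * y ^ i)
      = (p - inverse p) * (y * (x ^ i * y ^ j - x ^ j * y ^ i) / (y - x))"
    unfolding alpha by simp
  also have "y * (x ^ i * y ^ j - x ^ j * y ^ i) / (y - x) = ?S"
    unfolding eta_sum_telescope[OF assms(3,4), of y x, symmetric] using xy(2) by simp
  finally show ?thesis .
qed

section \<open>The gauge transformation\<close>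

text \<open>
  The entry of the left side in row \<open>(c, d)\<close> combines the entries of \<open>A\<^sub>1 A\<^sub>2\<close> in rows \<open>(c, d)\<close> and \<open>(d, c)\<close>; after
  removing the common factor \<open>r\<^sup>i\<close> the two sides agree by \<open>alpha_beta_eta\<close>.
\<close>
lemma R_op_intertwines:
  fixes q r :: "'f :: field"
  assumes q: "q \<noteq> 0" "q\<^sup>2 \<noteq> 1" and r0: "r \<noteq> 0" and r: "r ^ n = q\<^sup>2"
  shows "R_op n q \<odot> (A1 n q r \<odot> A2 n q r) = A1 n q r \<odot> A2 n q r \<odot> of_scalar_map (rho n q r)"
  unfolding A1_A2_eq_of_matrix[OF q(1) r] R_op_eq_of_matrix rho_eq_of_matrix
    of_matrix_lcomp[OF finite_VV_basis]
proof (rule of_matrix_cong)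
  fix u w :: "nat \<times> nat"
  obtain i j c d where uw: "u = (i, j)" "w = (c, d)" by (metis surj_pair)
  assume "u \<in> VV_basis n" "w \<in> VV_basis n"
  then have ij: "i \<in> {1..n}" "j \<in> {1..n}" and cd: "c \<in> {1..n}" "d \<in> {1..n}"
    by (auto simp: uw VV_basis_iff)
  define x where "x = shifted_node n q d c"
  define y :: "'f ffield" where "y = node n d"
  let ?T = "\<lambda>c d i j. (scal r * shifted_node n q d c) ^ i * node n d ^ j"
  let ?Q = "scal q" and ?\<alpha> = "alpha_fun (scal q) (x / y)" and ?\<beta> = "beta_fun (scal q) (x / y)"
  have Q0: "?Q \<noteq> 0" using scal_eq_iff[of q 0] q by (simp add: scal_0)
  have y0: "y \<noteq> 0" by (simp add: y_def node_nonzero)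
  \<comment> \<open>For \<open>c = d\<close> this is where \<open>q\<^sup>2 \<noteq> 1\<close> enters.\<close>
  have xy: "x \<noteq> y"
  proof
    assume "x = y"
    then have eq: "scal (if c = d then inverse (q\<^sup>2) else 1) * node n c = scal 1 * node n d"
      by (simp add: x_def y_def shifted_node_def scal_1)
    then have "c = d" by (rule scal_mult_node_eq) (simp add: q)
    then have "scal (inverse (q\<^sup>2)) = scal 1"
      using eq by (simp add: node_nonzero)
    then show False using q by (simp add: scal_eq_iff)
  qed
  \<comment> \<open>For \<open>c = d\<close> the two monomials differ, and it is the vanishing of \<open>\<beta>\<close> at \<open>q\<^bsup>-2\<^esup>\<close> that allows the exchange.\<close>
  have \<beta>T: "?\<beta> * ?T d c i j = ?\<beta> * (scal r ^ i * (y ^ i * x ^ j))"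
  proof (cases "c = d")
    case True
    then have "x / y = inverse (?Q\<^sup>2)"
      using y0 by (simp add: x_def y_def shifted_node_def scal_inverse scal_power)
    then have "?\<beta> = 0"
      using Q0 by (simp add: beta_fun_def power2_eq_square)
    then show ?thesis by simp
  next
    case False
    then show ?thesis
      by (simp add: x_def y_def shifted_node_def scal_1 power_mult_distrib mult.assoc)
  qed
  have "(\<Sum>v\<in>VV_basis n. (case w of (c, d) \<Rightarrow> \<lambda>(i, j).
        (if c = i \<and> d = j then alpha_fun (scal q) (root_ratio n q c d) else 0)
        + (if c = j \<and> d = i then beta_fun (scal q) (root_ratio n q c d) else 0)) v
      * (case v of (c, d) \<Rightarrow> \<lambda>(i, j). ?T c d i j) u)
    = (\<Sum>a=1..n. \<Sum>b=1..n. (if b = d then (if a = c then ?\<alpha> * ?T c d i j else 0) else 0)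
        + (if b = c then (if a = d then ?\<beta> * ?T d c i j else 0) else 0))"
    unfolding sum_VV_basis uw prod.case root_ratio_eq x_def y_def
    by (intro sum.cong refl) (simp add: distrib_right)
  also have "\<dots> = ?\<alpha> * ?T c d i j + ?\<beta> * ?T d c i j"
    using cd by (simp add: sum.distrib)
  also have "\<dots> = scal r ^ i * (?\<alpha> * (x ^ i * y ^ j) + ?\<beta> * (y ^ i * x ^ j))"
    unfolding \<beta>T by (simp add: x_def y_def power_mult_distrib distrib_left)
  also have "\<dots> = scal r ^ i * (?Q * (x ^ j * y ^ i)
      + (?Q - inverse ?Q) * (\<Sum>k=1..n. of_int (eta i j k) * (x ^ k * y ^ (i + j - k))))"
    by (simp only: alpha_beta_eta[OF y0 xy ij])
  also have "\<dots> = scal (q * r powi (int i - int j)) * ?T c d j i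
      + (\<Sum>k=1..n. scal ((q - inverse q) * r powi (int i - int k) * of_int (eta i j k))
          * ?T c d k (i + j - k))"
  proof -
    have rr: "scal (r powi (int i - int k)) * scal r ^ k = scal r ^ i" for k
      using r0 by (simp add: power_int_diff flip: scal_power scal_mult)
    have "scal (q * r powi (int i - int j)) * ?T c d j i
        = (scal (r powi (int i - int j)) * scal r ^ j) * (?Q * (x ^ j * y ^ i))"
      by (simp add: scal_mult x_def y_def power_mult_distrib mult_ac)
    moreover have "scal ((q - inverse q) * r powi (int i - int k) * of_int (eta i j k))
          * ?T c d k (i + j - k)
        = (scal (r powi (int i - int k)) * scal r ^ k) * ((?Q - inverse ?Q)
            * (of_int (eta i j k) * (x ^ k * y ^ (i + j - k))))" for k
      by (simp add: scal_mult scal_diff scal_inverse scal_of_int x_def y_def power_mult_distrib mult_ac)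
    ultimately show ?thesis
      by (simp only: rr distrib_left sum_distrib_left)
  qed
  also have "\<dots> = (\<Sum>k=1..n. \<Sum>l=1..n.
      (if l = i then (if k = j then scal (q * r powi (int i - int j)) * ?T c d j i else 0) else 0)
      + (if l = i + j - k then scal ((q - inverse q) * r powi (int i - int k) * of_int (eta i j k))
          * ?T c d k (i + j - k) else 0))"
  proof -
    have "(\<Sum>l=1..n. if l = i + j - k
          then scal ((q - inverse q) * r powi (int i - int k) * of_int (eta i j k))
            * ?T c d k (i + j - k) else 0)
        = scal ((q - inverse q) * r powi (int i - int k) * of_int (eta i j k))
            * ?T c d k (i + j - k)" for k
      using eta_nonzero_range[OF _ ij, of k] by (cases "eta i j k = 0") (auto simp: scal_0)
    then show ?thesis using ij by (simp add: sum.distrib)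
  qed
  also have "\<dots> = (\<Sum>v\<in>VV_basis n. (case w of (c, d) \<Rightarrow> \<lambda>(i, j). ?T c d i j) v
      * (case v of (k, l) \<Rightarrow> \<lambda>(i, j).
          (if k = j \<and> l = i then scal (q * r powi (int i - int j)) else 0)
          + (if l = i + j - k
             then scal ((q - inverse q) * r powi (int i - int k) * of_int (eta i j k)) else 0)) u)"
    unfolding sum_VV_basis uw prod.case
    by (intro sum.cong refl) (simp add: distrib_left mult.commute)
  finally show "(\<Sum>v\<in>VV_basis n. (case w of (c, d) \<Rightarrow> \<lambda>(i, j).
        (if c = i \<and> d = j then alpha_fun (scal q) (root_ratio n q c d) else 0)
        + (if c = j \<and> d = i then beta_fun (scal q) (root_ratio n q c d) else 0)) v
      * (case v of (c, d) \<Rightarrow> \<lambda>(i, j). ?T c d i j) u)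
    = (\<Sum>v\<in>VV_basis n. (case w of (c, d) \<Rightarrow> \<lambda>(i, j). ?T c d i j) v
      * (case v of (k, l) \<Rightarrow> \<lambda>(i, j).
          (if k = j \<and> l = i then scal (q * r powi (int i - int j)) else 0)
          + (if l = i + j - k
             then scal ((q - inverse q) * r powi (int i - int k) * of_int (eta i j k)) else 0)) u)" .
qed

lemma R_op_in_lmaps: "R_op n q \<in> lmaps (B_field n) (VV_basis n) (VV_basis n)"
proof -
  have scal: "scal c \<in> B_field n" for c :: 'a
    unfolding B_field_def by (rule scal_in_fracs) (simp add: root_lattice_def)
  have "K (wt_root n d c) \<in> (B_field n :: 'a ffield set)" if "c \<in> {1..n}" "d \<in> {1..n}" for c d
    unfolding B_field_def
    by (rule K_in_fracs) (use that in \<open>auto simp: root_lattice_def intro!: group_closure.base\<close>)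
  then have "root_ratio n q c d \<in> B_field n" if "c \<in> {1..n}" "d \<in> {1..n}" for c d
    unfolding root_ratio_def using that
    by (auto intro!: B_field.power B_field.mult B_field.inverse B_field.one scal)
  then show ?thesis
    unfolding R_op_eq_of_matrix
    by (intro of_matrix_in_lmaps finite_VV_basis)
       (auto simp: VV_basis_iff alpha_fun_def beta_fun_def
         intro!: B_field.zero B_field.one B_field.add B_field.divide B_field.diff B_field.mult
           B_field.inverse scal)
qed

lemma A_op_in_lmaps: "A_op n \<in> lmaps (B_ext n) (V_basis n) (V_basis n)"
  unfolding lmaps_def
proof (intro CollectI conjI ballI allI impI)
  show "A_op n i = 0" if "i \<notin> V_basis n" for i
    using that by (simp add: A_op_def)
qed (auto simp: keys_A_op lookup_A_op V_basis_def intro!: B_ext.power node_in_B_ext)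

theorem lemma3p4:
  fixes q r :: "'f :: field" and n :: nat
  assumes "1 \<le> n"
    and "q \<noteq> 0" and "q\<^sup>2 \<noteq> 1"
    and "r ^ n = q\<^sup>2"
  shows "(R_op n q :: (nat \<times> nat, nat \<times> nat, 'f ffield) lmap) \<in> lmaps (B_field n) (VV_basis n) (VV_basis n)
    \<and> (A_op n :: (nat, nat, 'f ffield) lmap) \<in> lmaps (B_ext n) (V_basis n) (V_basis n)
    \<and> invertible_map (B_ext n) (VV_basis n) (A1 n q r)
    \<and> invertible_map (B_ext n) (VV_basis n) (A2 n q r)
    \<and> R_gauge n q r = of_scalar_map (rho n q r)"
proof -
  have r0: "r \<noteq> 0" using assms by (auto simp: power_0_left)
  obtain g1 where g1: "is_inverse (B_ext n) (VV_basis n) (A1 n q r) g1"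
    using A1_invertible(1)[OF assms(2) r0 assms(4)] by blast
  obtain g2 where g2: "is_inverse (B_ext n) (VV_basis n) (A2 n q r) g2"
    using A2_invertible(1)[OF assms(2,4)] by blast
  note inv1 = invertible_mapI[OF finite_VV_basis A1_invertible(2)[OF assms(2) r0 assms(4)] g1]
  note inv2 = invertible_mapI[OF finite_VV_basis A2_invertible(2)[OF assms(2,4)] g2]
  have "R_gauge n q r = g2 \<odot> (g1 \<odot> (A1 n q r \<odot> (A2 n q r \<odot> of_scalar_map (rho n q r))))"
    unfolding R_gauge_def inv1(2) inv2(2)
    using R_op_intertwines[OF assms(2,3) r0 assms(4)] by (simp only: lcomp_assoc)
  also have "\<dots> = g2 \<odot> ((g1 \<odot> A1 n q r) \<odot> (A2 n q r \<odot> of_scalar_map (rho n q r)))"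
    by (simp only: lcomp_assoc)
  also have "\<dots> = (g2 \<odot> A2 n q r) \<odot> of_scalar_map (rho n q r)"
    using g1 unfolding is_inverse_def rho_eq_of_matrix A2_eq_of_matrix[OF assms(2,4)]
      of_matrix_lcomp[OF finite_VV_basis]
    by (simp only: lcomp_idmap[OF finite_VV_basis] lcomp_assoc of_matrix_lcomp[OF finite_VV_basis])
  also have "\<dots> = of_scalar_map (rho n q r)"
    using g2 unfolding is_inverse_def rho_eq_of_matrix
    by (simp only: lcomp_idmap[OF finite_VV_basis])
  finally show ?thesis
    using R_op_in_lmaps A_op_in_lmaps inv1(1) inv2(1) by blast
qed

end
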